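(* Let $a=\{a_1,\dots,a_m\}$ be a set of positive rational numbers different from $1$. Then, as formal power series in $x$ with coefficients in $\mathbb{Q}[t]$, $$\sum_{n\ge 0}\chi_{\mathcal{A}_n(a)}(t)\frac{x^n}{n!}=\Big(\sum_{n\ge 0}(-1)^n r(\mathcal{A}_n(a))\frac{x^n}{n!}\Big)^{-\frac{t-1}{2}},$$ where for a power series $F$ with constant term $1$, $F^{\alpha}:=\exp(\alpha\log F)$. Moreover, for fixed $m$ and $n$, $r(\mathcal{A}_n(a))$ is the same for all multiplicatively independent sets $a$ of size $m$.
   Context: A set $\{a_1,\dots,a_m\}$ of positive rational numbers is multiplicatively independent if $a_1^{i_1}\cdots a_m^{i_m}=1$ with integers $i_1,\dots,i_m$ implies $i_1=\dots=i_m=0$. For a set $a=\{a_1,\dots,a_m\}$ of positive rational numbers different from $1$ and $n\ge 1$, $\mathcal{A}_n(a)$ denotes the hyperplane arrangement in $\mathbb{R}^n$ consisting of the hyperplanes $x_i=0$ ($1\le i\le n$), $x_i=x_j$ ($1\le i<j\le n$), and $x_i=a_rx_j$ ($1\le i\neq j\le n$, $1\le r\le m$); $\mathcal{A}_0(a)$ is the empty arrangement in $\mathbb{R}^0$, with characteristic polynomial $1$ and one region. $r(\mathcal{A})$ denotes the number of connected components of $\mathbb{R}^n\setminus\bigcup_{H\in\mathcal{A}}H$. For a finite arrangement $\mathcal{A}$ of affine hyperplanes in $\mathbb{R}^n$, the characteristic polynomial is $\chi_{\mathcal{A}}(t)=\sum_{\mathcal{B}}(-1)^{\#\mathcal{B}}t^{n-\operatorname{rank}(\mathcal{B})}$,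 the sum over subsets $\mathcal{B}\subseteq\mathcal{A}$ whose hyperplanes have nonempty common intersection, where $\operatorname{rank}(\mathcal{B})$ is the dimension of the span of the normal vectors of the hyperplanes in $\mathcal{B}$. *)

theory Defs
  imports "HOL-Analysis.Analysis" "HOL-Library.Function_Algebras"
    "HOL-Computational_Algebra.Polynomial" "HOL-Computational_Algebra.Formal_Power_Series"
begin

text \<open>Points of R^n are functions nat => real vanishing at coordinates >= n
  (coordinates are indexed 0..n-1).  The topology is the product topology,
  which restricted to this set is the Euclidean topology of R^n.\<close>

definition Rn :: "nat \<Rightarrow> (nat \<Rightarrow> real) set" where
  "Rn n = {x. \<forall>i\<ge>n. x i = 0}"

definition dotn :: "nat \<Rightarrow> (nat \<Rightarrow> real) \<Rightarrow> (nat \<Rightarrow> real) \<Rightarrow> real" where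
  "dotn n c x = (\<Sum>i<n. c i * x i)"

definition affine_hyperplane :: "nat \<Rightarrow> (nat \<Rightarrow> real) \<Rightarrow> real \<Rightarrow> (nat \<Rightarrow> real) set" where
  "affine_hyperplane n c b = {x \<in> Rn n. dotn n c x = b}"

text \<open>All normal vectors of a hyperplane H (they are all proportional).\<close>
definition normals :: "nat \<Rightarrow> (nat \<Rightarrow> real) set \<Rightarrow> (nat \<Rightarrow> real) set" where
  "normals n H = {c \<in> Rn n. c \<noteq> 0 \<and> (\<exists>b. H = affine_hyperplane n c b)}"

definition arr_rank :: "nat \<Rightarrow> (nat \<Rightarrow> real) set set \<Rightarrow> nat" where
  "arr_rank n B = vector_space.dim (\<lambda>r (v :: nat \<Rightarrow> real). (\<lambda>i. r * v i)) (\<Union>H\<in>B. normals n H)"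

definition char_poly :: "nat \<Rightarrow> (nat \<Rightarrow> real) set set \<Rightarrow> rat poly" where
  "char_poly n A = (\<Sum>B \<in> {B. B \<subseteq> A \<and> \<Inter>B \<inter> Rn n \<noteq> {}}.
      monom ((-1) ^ card B) (n - arr_rank n B))"

definition regions :: "nat \<Rightarrow> (nat \<Rightarrow> real) set set \<Rightarrow> nat" where
  "regions n A = card (components (Rn n - \<Union>A))"

definition arrA :: "nat \<Rightarrow> rat set \<Rightarrow> (nat \<Rightarrow> real) set set" where
  "arrA n a =
     {affine_hyperplane n (\<lambda>k. if k = i then 1 else 0) 0 | i. i < n}
   \<union> {affine_hyperplane n (\<lambda>k. if k = i then 1 else if k = j then -1 else 0) 0 | i j. i < j \<and> j < n}
   \<union> {affine_hyperplane n (\<lambda>k. if k = i then 1 else if k = j then - of_rat r else 0) 0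
        | i j r. i < n \<and> j < n \<and> i \<noteq> j \<and> r \<in> a}"

definition mult_indep :: "rat set \<Rightarrow> bool" where
  "mult_indep S \<longleftrightarrow> (\<forall>e :: rat \<Rightarrow> int. (\<Prod>x\<in>S. x powi e x) = 1 \<longrightarrow> (\<forall>x\<in>S. e x = 0))"

text \<open>log F = sum_{k>=1} (-1)^(k+1) (F-1)^k / k  (for F with constant term 1).\<close>
definition fps_log1 :: "rat poly fps \<Rightarrow> rat poly fps" where
  "fps_log1 F = Abs_fps (\<lambda>n. \<Sum>k\<in>{1..n}. smult ((-1) ^ (k + 1) / of_nat k) (fps_nth ((F - 1) ^ k) n))"

text \<open>exp G = sum_{k>=0} G^k / k!  (for G with constant term 0).\<close>
definition fps_exp0 :: "rat poly fps \<Rightarrow> rat poly fps" where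
  "fps_exp0 G = Abs_fps (\<lambda>n. \<Sum>k\<le>n. smult (1 / fact k) (fps_nth (G ^ k) n))"

definition fps_powr_poly :: "rat poly fps \<Rightarrow> rat poly \<Rightarrow> rat poly fps" where
  "fps_powr_poly F \<alpha> = fps_exp0 (fps_const \<alpha> * fps_log1 F)"

end

theory Submission
  imports Defs
begin

text \<open>
  Read a set of hyperplanes as a gain graph on the coordinates. Splitting off the component \<open>K\<close> of a
  vertex \<open>v\<close> gives \<open>\<chi>(U) = (\<Sum>K. \<kappa>(K) * \<chi>(U - K))\<close>, where \<open>\<kappa>(K)\<close> is the sum over the connected edge sets
  on \<open>K\<close>. Such a set has rank \<open>card K\<close> or \<open>card K - 1\<close>, so \<open>\<kappa>(K)\<close> is linear in \<open>t\<close>, and \<open>\<kappa>(K)\<close> vanishes at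
  \<open>t = 1\<close> because \<open>\<chi>(K)\<close> does. Hence the generating function \<open>X\<close> of the \<open>\<chi>\<close> satisfies \<open>X' = (t - 1) B X\<close>
  with \<open>B\<close> independent of \<open>t\<close>. By Zaslavsky's theorem the series \<open>F\<close> of the region numbers is \<open>X\<close> at
  \<open>t = -1\<close>, so \<open>F' = -2 B F\<close>, and \<open>F\<close> to the power \<open>(1 - t) / 2\<close> solves the same differential equation
  as \<open>X\<close>. For multiplicatively independent gains the rank of an edge set does not depend on the gains.
\<close>

section \<open>Duality in coordinate space\<close>

interpretation fn: vector_space "\<lambda>r (v :: nat \<Rightarrow> real). (\<lambda>i. r * v i)"
  by unfold_locales (auto simp: fun_eq_iff algebra_simps)

text \<open>A maximal independent subset of \<open>S\<close> stays independent when a vector outside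
  its span is added. The ambient function space is infinite-dimensional, so finiteness is taken from
  \<open>S\<close>.\<close>

lemma fn_dim_insert:
  assumes "finite S"
  shows "fn.dim (insert x S) = (if x \<in> fn.span S then fn.dim S else Suc (fn.dim S))"
proof (cases "x \<in> fn.span S")
  case True
  then show ?thesis
    by (metis fn.dim_span fn.span_redundant)
next
  case False
  obtain B where B: "B \<subseteq> S" "fn.independent B" "S \<subseteq> fn.span B"
    using fn.maximal_independent_subset by blast
  have span: "fn.span B = fn.span S"
    using B fn.span_eq fn.span_superset by blast
  have "fn.independent (insert x B)"
    using B(2) False span by (simp add: fn.independent_insert)
  moreover have "fn.span (insert x B) = fn.span (insert x S)"
    by (simp only: fn.span_insert span)
  ultimately have "fn.dim (insert x S) = card (insert x B)"
    by (metis fn.dim_eq_card)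
  moreover have "fn.dim S = card B"
    using B(2) span by (metis fn.dim_eq_card)
  moreover have "x \<notin> B" "finite B"
    using False B(1) fn.span_base assms finite_subset by blast+
  ultimately show ?thesis
    using False by simp
qed

lemma dotn_simps:
  "dotn n (c + d) x = dotn n c x + dotn n d x"
  "dotn n (c - d) x = dotn n c x - dotn n d x"
  "dotn n (\<lambda>i. r * c i) x = r * dotn n c x"
  "dotn n c (x + y) = dotn n c x + dotn n c y"
  "dotn n c (x - y) = dotn n c x - dotn n c y"
  "dotn n c (\<lambda>i. r * x i) = r * dotn n c x"
  "dotn n 0 x = 0" "dotn n c 0 = 0"
  by (simp_all add: dotn_def algebra_simps sum.distrib sum_subtractf sum_distrib_left)

lemma Rn_simps:
  "0 \<in> Rn n" "c \<in> Rn n \<Longrightarrow> d \<in> Rn n \<Longrightarrow> c + d \<in> Rn n"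
  "c \<in> Rn n \<Longrightarrow> d \<in> Rn n \<Longrightarrow> c - d \<in> Rn n"
  "c \<in> Rn n \<Longrightarrow> (\<lambda>i. r * c i) \<in> Rn n"
  by (auto simp: Rn_def)

lemma dotn_span_eq_0:
  assumes "c \<in> fn.span C" "\<forall>d\<in>C. dotn n d x = 0"
  shows "dotn n c x = 0"
proof -
  have "fn.span C \<subseteq> {c. dotn n c x = 0}"
    using assms(2) by (intro fn.span_minimal fn.subspaceI) (auto simp: dotn_simps)
  then show ?thesis
    using assms(1) by blast
qed

text \<open>Elimination of \<open>d\<close>: replace \<open>c\<close> by \<open>c - k d\<close> vanishing at a solution \<open>w\<close> of \<open>C\<close> with \<open>d w \<noteq> 0\<close>, and
  correct the resulting solution along \<open>w\<close>.\<close>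

lemma dual_vector:
  assumes "finite C" "C \<subseteq> Rn n" "c \<in> Rn n" "c \<notin> fn.span C"
  shows "\<exists>v\<in>Rn n. (\<forall>d\<in>C. dotn n d v = 0) \<and> dotn n c v \<noteq> 0"
  using assms
proof (induction C arbitrary: c rule: finite_induct)
  case empty
  then obtain k where "c k \<noteq> 0"
    by (auto simp: fun_eq_iff)
  moreover have "k < n"
    using empty(2) \<open>c k \<noteq> 0\<close> unfolding Rn_def by (metis (mono_tags) mem_Collect_eq not_le)
  ultimately have "dotn n c c > 0"
    unfolding dotn_def by (intro sum_pos2[of _ k]) (auto simp: zero_less_mult_iff linorder_neq_iff)
  then show ?case
    using empty(2) by force
next
  case (insert d C)
  show ?case
  proof (cases "d \<in> fn.span C")
    case True
    then have "c \<notin> fn.span C"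
      using insert.prems(3) by (simp add: fn.span_redundant)
    then obtain v where "v \<in> Rn n" "\<forall>d\<in>C. dotn n d v = 0" "dotn n c v \<noteq> 0"
      using insert.IH[of c] insert.prems by auto
    then show ?thesis
      using dotn_span_eq_0[OF True] by auto
  next
    case False
    obtain w where w: "w \<in> Rn n" "\<forall>d\<in>C. dotn n d w = 0" "dotn n d w \<noteq> 0"
      using insert.IH[of d] insert.prems False by auto
    define k where "k = dotn n c w / dotn n d w"
    define c' where "c' = c - (\<lambda>i. k * d i)"
    have "c' \<notin> fn.span C"
      using insert.prems(3) by (auto simp: fn.span_insert c'_def)
    moreover have "c' \<in> Rn n"
      using insert.prems by (auto simp: c'_def intro!: Rn_simps)
    ultimately obtain v where v: "v \<in> Rn n" "\<forall>d\<in>C. dotn n d v = 0" "dotn n c' v \<noteq> 0"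
      using insert.IH[of c'] insert.prems by auto
    define l where "l = dotn n d v / dotn n d w"
    define v' where "v' = v - (\<lambda>i. l * w i)"
    have "v' \<in> Rn n"
      unfolding v'_def by (intro Rn_simps v w)
    moreover have "\<forall>d\<in>insert d C. dotn n d v' = 0"
      unfolding v'_def dotn_simps using v w by (auto simp: l_def)
    moreover have "dotn n c v' = dotn n c' v"
      unfolding v'_def c'_def dotn_simps using w(3) by (simp add: k_def l_def)
    ultimately show ?thesis
      using v(3) by metis
  qed
qed

text \<open>Turns linear dependence of normals into an implication between equations, the form in
  which dependence of edges is handled later.\<close>

lemma in_span_iff_dotn:
  assumes "finite C" "C \<subseteq> Rn n" "c \<in> Rn n"
  shows "c \<in> fn.span C \<longleftrightarrow> (\<forall>x. (\<forall>d\<in>C. dotn n d x = 0) \<longrightarrow> dotn n c x = 0)"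
  using dual_vector[OF assms] dotn_span_eq_0 by blast

section \<open>Regions and sign vectors\<close>

text \<open>Only the positive part is recorded: off the hyperplanes no value is 0, so it determines
  all signs.\<close>

definition sign_vec :: "nat \<Rightarrow> ('e \<Rightarrow> nat \<Rightarrow> real) \<Rightarrow> 'e set \<Rightarrow> (nat \<Rightarrow> real) \<Rightarrow> 'e set" where
  "sign_vec n v E x = {e\<in>E. dotn n (v e) x > 0}"

definition complement ::
  "nat \<Rightarrow> ('e \<Rightarrow> nat \<Rightarrow> real) \<Rightarrow> (nat \<Rightarrow> real) set \<Rightarrow> 'e set \<Rightarrow> (nat \<Rightarrow> real) set" where
  "complement n v C E =
     {x\<in>Rn n. (\<forall>c\<in>C. dotn n c x = 0) \<and> (\<forall>e\<in>E. dotn n (v e) x \<noteq> 0)}"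

section \<open>Components of the complement of an arrangement\<close>

lemma continuous_on_dotn: "continuous_on A (dotn n c)"
proof -
  have "continuous_on UNIV (\<lambda>x. \<Sum>i<n. c i * x i)"
    by (intro continuous_on_sum continuous_on_mult continuous_on_const
        continuous_on_product_coordinates)
  then show ?thesis
    unfolding dotn_def using continuous_on_subset by blast
qed

lemma connected_segments:
  fixes A :: "(nat \<Rightarrow> real) set"
  assumes "\<And>x y t. x \<in> A \<Longrightarrow> y \<in> A \<Longrightarrow> 0 \<le> t \<Longrightarrow> t \<le> 1 \<Longrightarrow> (\<lambda>i. (1 - t) * x i + t * y i) \<in> A"
  shows "connected A"
proof -
  have "connected_component A x y" if xy: "x \<in> A" "y \<in> A" for x y
  proof -
    let ?f = "\<lambda>t i. (1 - t) * x i + t * y i"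
    have "continuous_on {0..1} ?f"
      by (intro continuous_on_coordinatewise_then_product continuous_intros)
    then have "connected (?f ` {0..1::real})"
      by (rule connected_continuous_image) simp
    moreover have "?f ` {0..1} \<subseteq> A"
      using assms xy by auto
    moreover have "x \<in> ?f ` {0..1}" "y \<in> ?f ` {0..1}"
      by (rule image_eqI[of _ _ 0], auto, rule image_eqI[of _ _ 1], auto)
    ultimately show ?thesis
      unfolding connected_component_def by blast
  qed
  then show ?thesis
    by (simp add: connected_iff_connected_component)
qed

text \<open>The points sharing the sign vector of \<open>x\<close> form a convex, hence connected
  set, and strict sign conditions are open, so this set is exactly the component of
  \<open>x\<close>.\<close>

lemma card_components_complement:
  assumes "finite E"
  shows "card (components (complement n v {} E)) = card (sign_vec n v E ` complement n v {} E)"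
proof -
  let ?M = "complement n v {} E" and ?s = "sign_vec n v E"
  define F where "F x = {y\<in>?M. ?s y = ?s x}" for x
  have F: "connected_component_set ?M x = F x" if x: "x \<in> ?M" for x
  proof
    show "F x \<subseteq> connected_component_set ?M x"
    proof (rule connected_component_maximal)
      have F_iff: "y \<in> F x \<longleftrightarrow> y \<in> Rn n \<and> (\<forall>e\<in>E. (e \<in> ?s x \<and> dotn n (v e) y > 0) \<or>
          (e \<notin> ?s x \<and> dotn n (v e) y < 0))" for y
        using x by (auto simp: F_def complement_def sign_vec_def set_eq_iff not_less less_le)
      show "connected (F x)"
      proof (rule connected_segments)
        fix y z and t :: real
        assume y: "y \<in> F x" and z: "z \<in> F x" and t: "0 \<le> t" "t \<le> 1"
        let ?w = "\<lambda>i. (1 - t) * y i + t * z i"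
        have dot: "dotn n c ?w = (1 - t) * dotn n c y + t * dotn n c z" for c
          by (simp add: dotn_def sum.distrib sum_distrib_left algebra_simps sum_subtractf)
        have pos: "(1 - t) * p + t * q > 0" if "p > 0" "q > 0" for p q
        proof (cases "t = 0")
          case False
          then show ?thesis
            using t that by (intro add_nonneg_pos) auto
        qed (use that in auto)
        have neg: "(1 - t) * p + t * q < 0" if "p < 0" "q < 0" for p q
          using pos[of "- p" "- q"] that by (simp add: algebra_simps)
        have "?w \<in> Rn n"
          using y z by (auto simp: F_iff Rn_def)
        then show "?w \<in> F x"
          unfolding F_iff using y z by (metis F_iff dot pos neg)
      qed
    qed (use x in \<open>auto simp: F_def\<close>)
  next
    let ?C = "connected_component_set ?M x"
    \<comment> \<open>\<open>U\<close> fixes the strict signs of \<open>x\<close>, \<open>V\<close>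
      demands some opposite strict sign. These are disjoint open sets covering \<open>?M\<close>, so
      the component of \<open>x\<close> stays in \<open>U\<close>.\<close>
    define U where "U = (\<Inter>e\<in>E. if e \<in> ?s x then dotn n (v e) -` {0<..} else dotn n (v e) -` {..<0})"
    define V where "V = (\<Union>e\<in>E. if e \<in> ?s x then dotn n (v e) -` {..<0} else dotn n (v e) -` {0<..})"
    have op: "open (dotn n c -` S)" if "open S" for c S
      using continuous_on_dotn that by (metis continuous_on_open_vimage open_UNIV Int_UNIV_right)
    have "open U" "open V"
      unfolding U_def V_def using assms op by (auto intro!: open_INT open_UN)
    moreover have "U \<inter> V \<inter> ?C = {}"
    proof -
      have "y \<notin> V" if "y \<in> U" for y
      proof
        assume "y \<in> V"
        then obtain e where e: "e \<in> E"
          "y \<in> (if e \<in> ?s x then dotn n (v e) -` {..<0} else dotn n (v e) -` {0<..})"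
          unfolding V_def by blast
        have "y \<in> (if e \<in> ?s x then dotn n (v e) -` {0<..} else dotn n (v e) -` {..<0})"
          using that e(1) unfolding U_def by blast
        then show False
          using e(2) by (auto split: if_splits)
      qed
      then show ?thesis
        by blast
    qed
    moreover have UV: "?C \<subseteq> U \<union> V"
    proof
      fix y assume "y \<in> ?C"
      then have "y \<in> ?M"
        using connected_component_subset by blast
      then show "y \<in> U \<union> V"
        by (auto simp: complement_def linorder_neq_iff U_def V_def)
    qed
    moreover have "x \<in> U"
      using x by (auto simp: complement_def sign_vec_def not_less less_le U_def)
    moreover have "x \<in> ?C"
      using x by (simp add: connected_component_refl)
    ultimately have "V \<inter> ?C = {}"
      using connectedD[OF connected_connected_component[of ?M x], of U V] by blast
    then have CU: "?C \<subseteq> U"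
      using UV by blast
    show "?C \<subseteq> F x"
    proof
      fix y assume y: "y \<in> ?C"
      then have "y \<in> U" "y \<in> ?M"
        using CU connected_component_subset by blast+
      have "e \<in> ?s x \<longleftrightarrow> dotn n (v e) y > 0" if "e \<in> E" for e
      proof -
        have "y \<in> (if e \<in> ?s x then dotn n (v e) -` {0<..} else dotn n (v e) -` {..<0})"
          using \<open>y \<in> U\<close> that unfolding U_def by blast
        then show ?thesis
          by (auto split: if_splits)
      qed
      then have "?s y = ?s x"
        unfolding sign_vec_def by blast
      then show "y \<in> F x"
        using \<open>y \<in> ?M\<close> by (simp add: F_def)
    qed
  qed
  have "components ?M = (\<lambda>k. {y\<in>?M. ?s y = k}) ` (?s ` ?M)"
    unfolding components_def image_image using F by (simp add: F_def)
  moreover have "inj_on (\<lambda>k. {y\<in>?M. ?s y = k}) (?s ` ?M)"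
    by (rule inj_onI) blast
  ultimately show ?thesis
    by (simp add: card_image)
qed

section \<open>Counting regions by deletion and restriction\<close>

lemma sum_Pow_insert:
  assumes "finite E" "e \<notin> E"
  shows "(\<Sum>S\<in>Pow (insert e E). f S) = (\<Sum>S\<in>Pow E. f S) + (\<Sum>S\<in>Pow E. f (insert e S))"
proof -
  have "(\<Sum>S\<in>Pow (insert e E). f S) = (\<Sum>S\<in>Pow E. f S) + (\<Sum>S\<in>insert e ` Pow E. f S)"
    unfolding Pow_insert using assms by (intro sum.union_disjoint) auto
  moreover have "inj_on (insert e) (Pow E)"
    using assms(2) by (intro inj_onI) (metis PowD insert_ident subsetD)
  ultimately show ?thesis
    by (simp add: sum.reindex)
qed

lemma small_perturbation:
  fixes p q :: "'e \<Rightarrow> real"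
  assumes "finite E" "\<forall>e\<in>E. p e \<noteq> 0"
  shows "\<exists>\<delta>>0. \<forall>t. \<bar>t\<bar> \<le> \<delta> \<longrightarrow> (\<forall>e\<in>E. sgn (p e + t * q e) = sgn (p e))"
  using assms
proof (induction E rule: finite_induct)
  case empty
  show ?case
    by (auto intro: exI[of _ 1])
next
  case (insert e E)
  then obtain \<delta> where \<delta>: "\<delta> > 0" "\<forall>t. \<bar>t\<bar> \<le> \<delta> \<longrightarrow> (\<forall>e\<in>E. sgn (p e + t * q e) = sgn (p e))"
    by auto
  \<comment> \<open>The summand 1 keeps the denominator positive and makes \<open>t * q e\<close>
    strictly smaller than \<open>p e\<close> in absolute value.\<close>
  define \<epsilon> where "\<epsilon> = \<bar>p e\<bar> / (1 + \<bar>q e\<bar>)"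
  have "\<epsilon> > 0"
    using insert.prems by (simp add: \<epsilon>_def add_pos_nonneg)
  have "sgn (p e + t * q e) = sgn (p e)" if "\<bar>t\<bar> \<le> \<epsilon>" for t
  proof -
    have "\<bar>t * q e\<bar> \<le> \<epsilon> * \<bar>q e\<bar>"
      using that by (simp add: abs_mult mult_right_mono)
    also have "\<dots> < \<epsilon> * (1 + \<bar>q e\<bar>)"
      using \<open>\<epsilon> > 0\<close> by simp
    also have "\<dots> = \<bar>p e\<bar>"
      by (simp add: \<epsilon>_def add_nonneg_eq_0_iff)
    finally show ?thesis
      by (auto simp: sgn_if abs_if split: if_splits)
  qed
  then show ?case
    using \<delta> \<open>\<epsilon> > 0\<close> by (intro exI[of _ "min \<delta> \<epsilon>"]) auto
qed

text \<open>Each region of \<open>E\<close> lies on one side of the new hyperplane or is cut in two.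
  With \<open>P\<close> and \<open>N\<close> the sign vectors met on the two sides,
  \<open>card P + card N\<close> equals \<open>card (P \<union> N) + card (P \<inter> N)\<close>:
  all regions plus those that are cut.\<close>

lemma card_sign_vec_insert:
  assumes "finite E" "e \<notin> E" "finite C" "C \<subseteq> Rn n" "v e \<in> Rn n" "v e \<notin> fn.span C"
  shows "card (sign_vec n v (insert e E) ` complement n v C (insert e E)) =
    card (sign_vec n v E ` complement n v C E) +
    card (sign_vec n v E ` complement n v (insert (v e) C) E)"
proof -
  let ?M = "complement n v C E" and ?s = "sign_vec n v E"
  let ?f = "dotn n (v e)"
  define P N where "P = ?s ` {x\<in>?M. ?f x > 0}" and "N = ?s ` {x\<in>?M. ?f x < 0}"
  have fin: "finite P" "finite N"
    using assms(1) by (auto simp: P_def N_def sign_vec_def intro: finite_subset[of _ "Pow E"])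
  obtain w0 where w0: "w0 \<in> Rn n" "\<forall>c\<in>C. dotn n c w0 = 0" "?f w0 \<noteq> 0"
    using dual_vector assms(3-6) by blast
  \<comment> \<open>Scaled so that moving by \<open>t\<close> times \<open>w\<close> changes
    \<open>?f\<close> by exactly \<open>t\<close> while staying in the subspace cut out by
    \<open>C\<close>.\<close>
  define w where "w = (\<lambda>i. (1 / ?f w0) * w0 i)"
  have w: "w \<in> Rn n" "\<forall>c\<in>C. dotn n c w = 0" "?f w = 1"
    unfolding w_def dotn_simps using w0 by (simp_all only: Rn_simps) simp_all
  \<comment> \<open>A point on the new hyperplane can be nudged along \<open>w\<close> to either
    side without changing a sign in \<open>E\<close>.\<close>
  have mid: "?s x \<in> P \<inter> N" if x: "x \<in> ?M" "?f x = 0" for x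
  proof -
    obtain \<delta> where \<delta>: "\<delta> > 0"
      "\<forall>t. \<bar>t\<bar> \<le> \<delta> \<longrightarrow>
         (\<forall>e\<in>E. sgn (dotn n (v e) x + t * dotn n (v e) w) = sgn (dotn n (v e) x))"
      using small_perturbation[OF assms(1), of "\<lambda>e. dotn n (v e) x" "\<lambda>e. dotn n (v e) w"] x
      by (auto simp: complement_def)
    have "x + (\<lambda>i. t * w i) \<in> ?M \<and> ?s (x + (\<lambda>i. t * w i)) = ?s x \<and> ?f (x + (\<lambda>i. t * w i)) = t"
      if "\<bar>t\<bar> \<le> \<delta>" for t
    proof -
      have "dotn n (v e) x + t * dotn n (v e) w > 0 \<longleftrightarrow> dotn n (v e) x > 0" 
           "dotn n (v e) x + t * dotn n (v e) w \<noteq> 0" if "e \<in> E" for e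
      proof -
        have "sgn (dotn n (v e) x + t * dotn n (v e) w) = sgn (dotn n (v e) x)"
          using \<delta>(2) \<open>\<bar>t\<bar> \<le> \<delta>\<close> that by blast
        moreover have "dotn n (v e) x \<noteq> 0"
          using x that by (simp add: complement_def)
        ultimately show "dotn n (v e) x + t * dotn n (v e) w > 0 \<longleftrightarrow> dotn n (v e) x > 0"
          "dotn n (v e) x + t * dotn n (v e) w \<noteq> 0"
          by (metis sgn_1_pos, metis sgn_0_0)
      qed
      then show ?thesis
        using x w by (auto simp: complement_def sign_vec_def dotn_simps intro!: Rn_simps)
    qed
    note near = this
    have "?s x \<in> P"
      unfolding P_def by (rule image_eqI[of _ _ "x + (\<lambda>i. \<delta> * w i)"]) (use near[of \<delta>] \<delta>(1) in auto)
    moreover have "?s x \<in> N"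
      unfolding N_def by (rule image_eqI[of _ _ "x + (\<lambda>i. - \<delta> * w i)"]) (use near[of "- \<delta>"] \<delta>(1) in auto)
    ultimately show ?thesis
      by blast
  qed
  have "sign_vec n v (insert e E) ` complement n v C (insert e E) = insert e ` P \<union> N"
  proof -
    have "complement n v C (insert e E) = {x\<in>?M. ?f x > 0} \<union> {x\<in>?M. ?f x < 0}"
      by (auto simp: complement_def)
    moreover have "sign_vec n v (insert e E) ` {x\<in>?M. ?f x > 0} = insert e ` P"
      unfolding P_def image_image by (rule image_cong) (auto simp: sign_vec_def)
    moreover have "sign_vec n v (insert e E) ` {x\<in>?M. ?f x < 0} = N"
      unfolding N_def by (rule image_cong) (auto simp: sign_vec_def)
    ultimately show ?thesis
      by (simp add: image_Un)
  qed
  moreover have "insert e ` P \<inter> N = {}"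
    using assms(2) by (auto simp: N_def sign_vec_def)
  moreover have "inj_on (insert e) P"
    using assms(2) by (intro inj_onI) (auto simp: P_def sign_vec_def)
  ultimately have "card (sign_vec n v (insert e E) ` complement n v C (insert e E)) = card P + card N"
    using fin by (simp add: card_Un_disjoint card_image)
  also have "\<dots> = card (P \<union> N) + card (P \<inter> N)"
    using fin by (rule card_Un_Int)
  also have "P \<union> N = ?s ` ?M"
  proof
    show "?s ` ?M \<subseteq> P \<union> N"
    proof
      fix k assume "k \<in> ?s ` ?M"
      then obtain x where "x \<in> ?M" "k = ?s x" by blast
      then show "k \<in> P \<union> N"
        using mid[of x] by (cases "?f x" "0::real" rule: linorder_cases) (auto simp: P_def N_def)
    qed
  qed (auto simp: P_def N_def)
  also have "P \<inter> N = ?s ` complement n v (insert (v e) C) E"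
  proof
    show "?s ` complement n v (insert (v e) C) E \<subseteq> P \<inter> N"
    proof
      fix k assume "k \<in> ?s ` complement n v (insert (v e) C) E"
      then obtain x where "x \<in> ?M" "?f x = 0" "k = ?s x"
        by (auto simp: complement_def)
      then show "k \<in> P \<inter> N"
        using mid by blast
    qed
    show "P \<inter> N \<subseteq> ?s ` complement n v (insert (v e) C) E"
    proof
      fix k assume "k \<in> P \<inter> N"
      then obtain x y where x: "x \<in> ?M" "?f x > 0" "k = ?s x" and y: "y \<in> ?M" "?f y < 0" "k = ?s y"
        by (auto simp: P_def N_def)
      \<comment> \<open>A positive combination of \<open>x\<close> and \<open>y\<close>, weighted to
        lie on the new hyperplane; it keeps every sign that \<open>x\<close> and \<open>y\<close>
        share.\<close>
      define z where "z = (\<lambda>i. (- ?f y) * x i) + (\<lambda>i. ?f x * y i)"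
      have z: "dotn n c z = (- ?f y) * dotn n c x + ?f x * dotn n c y" for c
        unfolding z_def dotn_simps by simp
      have sgn: "(dotn n (v d) z > 0 \<longleftrightarrow> dotn n (v d) x > 0) \<and> dotn n (v d) z \<noteq> 0" if "d \<in> E" for d
      proof (cases "d \<in> k")
        case True
        then have "dotn n (v d) x > 0" "dotn n (v d) y > 0"
          using x y by (auto simp: sign_vec_def)
        then have "dotn n (v d) z > 0"
          unfolding z using x(2) y(2) by (intro add_pos_pos mult_pos_pos) auto
        then show ?thesis
          using \<open>dotn n (v d) x > 0\<close> by auto
      next
        case False
        then have "\<not> dotn n (v d) x > 0" "\<not> dotn n (v d) y > 0"
          using x(3) y(3) that by (auto simp: sign_vec_def)
        moreover have "dotn n (v d) x \<noteq> 0" "dotn n (v d) y \<noteq> 0"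
          using x(1) y(1) that by (auto simp: complement_def)
        ultimately have "dotn n (v d) x < 0" "dotn n (v d) y < 0"
          by simp_all
        then have "dotn n (v d) z < 0"
          unfolding z using x(2) y(2) by (intro add_neg_neg mult_pos_neg) auto
        then show ?thesis
          using \<open>dotn n (v d) x < 0\<close> by auto
      qed
      have "z \<in> Rn n"
        unfolding z_def by (intro Rn_simps) (use x y in \<open>auto simp: complement_def\<close>)
      moreover have "dotn n c z = 0" if "c \<in> insert (v e) C" for c
        using that x(1) y(1) unfolding z by (auto simp: complement_def)
      ultimately have "z \<in> complement n v (insert (v e) C) E"
        using sgn by (auto simp: complement_def)
      moreover have "?s z = k"
        using sgn x(3) by (auto simp: sign_vec_def)
      ultimately show "k \<in> ?s ` complement n v (insert (v e) C) E"
        by blast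
    qed
  qed
  finally show ?thesis .
qed

text \<open>Zaslavsky's theorem relative to the subspace orthogonal to \<open>C\<close>, so that restriction to a
  hyperplane just adds its normal to \<open>C\<close>. The family \<open>v\<close> need not be injective.\<close>

lemma card_sign_vec:
  assumes "finite E" "v ` E \<subseteq> Rn n" "finite C" "C \<subseteq> Rn n"
  shows "int (card (sign_vec n v E ` complement n v C E)) =
    (\<Sum>S\<in>Pow E. (-1) ^ card S * (-1) ^ (fn.dim (C \<union> v ` S) + fn.dim C))"
  using assms
proof (induction E arbitrary: C rule: finite_induct)
  case empty
  have "0 \<in> complement n v C {}"
    by (auto simp: complement_def dotn_simps Rn_simps)
  then have "sign_vec n v {} ` complement n v C {} = {{}}"
    by (auto simp: sign_vec_def)
  then show ?case
    by (simp flip: mult_2)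
next
  case (insert e E)
  note C = insert.prems(2,3)
  have card_ins: "card (insert e S) = Suc (card S)" if "S \<in> Pow E" for S
    using that insert.hyps by (meson card_insert_disjoint finite_subset PowD subsetD)
  show ?case
  proof (cases "v e \<in> fn.span C")
    case True
    \<comment> \<open>A normal in the span of \<open>C\<close> vanishes on the whole subspace, and
      in the sum the subsets with and without \<open>e\<close> cancel.\<close>
    have "complement n v C (insert e E) = {}"
      using dotn_span_eq_0[OF True] by (auto simp: complement_def)
    moreover have "fn.dim (C \<union> v ` insert e S) = fn.dim (C \<union> v ` S)" for S
    proof -
      have "v e \<in> fn.span (C \<union> v ` S)"
        using True fn.span_mono by blast
      then have "fn.span (C \<union> v ` insert e S) = fn.span (C \<union> v ` S)"
        using fn.span_redundant[of "v e" "C \<union> v ` S"] by simp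
      then show ?thesis
        by (rule fn.span_eq_dim)
    qed
    ultimately show ?thesis
      using insert.hyps card_ins
      by (simp add: sum_Pow_insert flip: sum.distrib)
  next
    case False
    \<comment> \<open>Raising \<open>fn.dim C\<close> by one supplies the sign that
      \<open>card (insert e S)\<close> contributes.\<close>
    have dim: "fn.dim (insert (v e) C) = Suc (fn.dim C)"
      using fn_dim_insert[OF C(1)] False by simp
    have "int (card (sign_vec n v (insert e E) ` complement n v C (insert e E))) =
      (\<Sum>S\<in>Pow E. (-1) ^ card S * (-1) ^ (fn.dim (C \<union> v ` S) + fn.dim C)) +
      (\<Sum>S\<in>Pow E. (-1) ^ card S * (-1) ^ (fn.dim (insert (v e) C \<union> v ` S) + fn.dim (insert (v e) C)))"
      using card_sign_vec_insert[of E e C n v] insert.hyps insert.prems False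
        insert.IH[of C] insert.IH[of "insert (v e) C"] by simp
    then show ?thesis
      using insert.hyps card_ins by (simp add: sum_Pow_insert dim sum_negf)
  qed
qed

section \<open>Gain graphs and their rank\<close>

text \<open>\<open>Half i\<close> is the hyperplane \<open>x i = 0\<close> and \<open>Link i j d\<close> is \<open>x i = g d * x j\<close>; the labels \<open>d\<close> are kept
  separate from the gains \<open>g d\<close> in order to compare different gains on the same edges. Distinct edges
  may describe the same hyperplane.\<close>

datatype 'd edge = Half nat | Link nat nat 'd

fun verts :: "'d edge \<Rightarrow> nat set" where
  "verts (Half i) = {i}"
| "verts (Link i j d) = {i, j}"

fun edge_form :: "('d \<Rightarrow> real) \<Rightarrow> 'd edge \<Rightarrow> (nat \<Rightarrow> real) \<Rightarrow> real" where
  "edge_form g (Half i) x = x i"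
| "edge_form g (Link i j d) x = x i - g d * x j"

fun normal :: "('d \<Rightarrow> real) \<Rightarrow> 'd edge \<Rightarrow> nat \<Rightarrow> real" where
  "normal g (Half i) = (\<lambda>k. if k = i then 1 else 0)"
| "normal g (Link i j d) = (\<lambda>k. if k = i then 1 else if k = j then - g d else 0)"

text \<open>Links run over ordered pairs, so a label of gain 1 yields each equality of two
  coordinates twice.\<close>

definition edges :: "nat set \<Rightarrow> 'd set \<Rightarrow> 'd edge set" where
  "edges U D = Half ` U \<union> {Link i j d | i j d. i \<in> U \<and> j \<in> U \<and> i \<noteq> j \<and> d \<in> D}"

definition rk :: "('d \<Rightarrow> real) \<Rightarrow> 'd edge set \<Rightarrow> nat" where
  "rk g S = fn.dim (normal g ` S)"

text \<open>Linear dependence of the normal of \<open>e\<close> on those of \<open>S\<close>,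
  phrased through solutions so that no ambient dimension enters; \<open>normal_in_span_iff\<close>
  gives the equivalence.\<close>

definition dep :: "('d \<Rightarrow> real) \<Rightarrow> 'd edge set \<Rightarrow> 'd edge \<Rightarrow> bool" where
  "dep g S e \<longleftrightarrow> (\<forall>x. (\<forall>s\<in>S. edge_form g s x = 0) \<longrightarrow> edge_form g e x = 0)"

lemma Half_in_edges [simp]: "Half i \<in> edges U D \<longleftrightarrow> i \<in> U"
  by (auto simp: edges_def)

lemma Link_in_edges [simp]: "Link i j d \<in> edges U D \<longleftrightarrow> i \<in> U \<and> j \<in> U \<and> i \<noteq> j \<and> d \<in> D"
  by (auto simp: edges_def)

lemma edges_mono: "U \<subseteq> V \<Longrightarrow> edges U D \<subseteq> edges V D"
  by (auto simp: edges_def)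

lemma finite_edges: "finite U \<Longrightarrow> finite D \<Longrightarrow> finite (edges U D)"
proof -
  assume "finite U" "finite D"
  then have "finite ((\<lambda>(i, j, d). Link i j d) ` (U \<times> U \<times> D))"
    by blast
  moreover have "{Link i j d | i j d. i \<in> U \<and> j \<in> U \<and> i \<noteq> j \<and> d \<in> D}
      \<subseteq> (\<lambda>(i, j, d). Link i j d) ` (U \<times> U \<times> D)"
    by force
  ultimately show ?thesis
    unfolding edges_def using \<open>finite U\<close> by (auto intro: finite_subset)
qed

lemma edges_iff_verts:
  "U \<subseteq> V \<Longrightarrow> e \<in> edges U D \<longleftrightarrow> e \<in> edges V D \<and> verts e \<subseteq> U"
  by (cases e) auto

lemma verts_subset: "e \<in> edges U D \<Longrightarrow> verts e \<subseteq> U"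
  by (cases e) auto

lemma verts_nonempty: "verts e \<noteq> {}"
  by (cases e) auto

lemma edge_form_cong: "(\<And>i. i \<in> verts e \<Longrightarrow> x i = y i) \<Longrightarrow> edge_form g e x = edge_form g e y"
  by (cases e) auto

lemma edge_form_zero [simp]: "edge_form g e (\<lambda>_. 0) = 0"
  by (cases e) auto

lemma normal_in_Rn: "e \<in> edges {..<n} D \<Longrightarrow> normal g e \<in> Rn n"
  by (cases e) (auto simp: Rn_def)

lemma dotn_normal: "e \<in> edges {..<n} D \<Longrightarrow> dotn n (normal g e) x = edge_form g e x"
proof (cases e)
  case (Half i)
  moreover assume "e \<in> edges {..<n} D"
  ultimately show ?thesis
    by (simp add: dotn_def if_distrib[where f = "\<lambda>c. c * _"] cong: if_cong)
next
  case (Link i j d)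
  moreover assume "e \<in> edges {..<n} D"
  moreover have "(\<Sum>k<n. (if k = i then 1 else if k = j then - g d else 0) * x k) =
      (\<Sum>k<n. (if k = i then x k else 0) + (if k = j then - g d * x k else 0))" if "i \<noteq> j"
    using that by (intro sum.cong) auto
  ultimately show ?thesis
    by (simp add: dotn_def sum.distrib)
qed

section \<open>Rank computed from the dependence relation\<close>

lemma finite_edges_bounded:
  assumes "finite U"
  obtains n where "edges U D \<subseteq> edges {..<n} D"
  using assms edges_mono by (metis finite_nat_iff_bounded)

lemma normal_in_span_iff:
  assumes "finite U" "finite S" "S \<subseteq> edges U D" "e \<in> edges U D"
  shows "normal g e \<in> fn.span (normal g ` S) \<longleftrightarrow> dep g S e"
proof -
  obtain n where n: "edges U D \<subseteq> edges {..<n} D"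
    using finite_edges_bounded[OF assms(1)] .
  then have "normal g ` S \<subseteq> Rn n" "normal g e \<in> Rn n"
    using assms normal_in_Rn by blast+
  then have "normal g e \<in> fn.span (normal g ` S) \<longleftrightarrow>
      (\<forall>x. (\<forall>d\<in>normal g ` S. dotn n d x = 0) \<longrightarrow> dotn n (normal g e) x = 0)"
    using assms(2) by (intro in_span_iff_dotn) auto
  moreover have "dotn n (normal g d) x = edge_form g d x" if "d \<in> insert e S" for d x
    using that n assms dotn_normal by blast
  ultimately show ?thesis
    by (simp add: dep_def)
qed

lemma rk_insert:
  assumes "finite U" "finite S" "S \<subseteq> edges U D" "e \<in> edges U D"
  shows "rk g (insert e S) = (if dep g S e then rk g S else Suc (rk g S))"
  using assms by (simp add: rk_def fn_dim_insert normal_in_span_iff)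

lemma rk_empty [simp]: "rk g {} = 0"
  unfolding rk_def using fn.dim_le_card[of "{}" "{}"] by simp

lemma dep_mono: "dep g S e \<Longrightarrow> S \<subseteq> T \<Longrightarrow> dep g T e"
  unfolding dep_def by blast

lemma rk_Un_dep:
  assumes "finite T" "finite U" "finite S" "S \<subseteq> edges U D" "T \<subseteq> edges U D" "\<forall>e\<in>T. dep g S e"
  shows "rk g (S \<union> T) = rk g S"
  using assms
proof (induction T rule: finite_induct)
  case (insert e T)
  then have "dep g (S \<union> T) e"
    using dep_mono by (metis insertI1 Un_upper1)
  then show ?case
    using insert rk_insert[of U "S \<union> T" D e g] by simp
qed simp

lemma rk_le_Un:
  assumes "finite T" "finite U" "finite S" "S \<subseteq> edges U D" "T \<subseteq> edges U D"
  shows "rk g S \<le> rk g (S \<union> T)"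
  using assms by (induction T rule: finite_induct) (auto simp: rk_insert)

lemma rk_Half:
  assumes "finite K"
  shows "rk g (Half ` K) = card K"
  using assms
proof (induction K rule: finite_induct)
  case (insert i K)
  have "\<not> dep g (Half ` K) (Half i)"
    using insert.hyps unfolding dep_def
    by (intro notI) (drule spec[of _ "\<lambda>k. if k = i then 1 else 0"], auto split: if_splits)
  moreover have "Half ` K \<subseteq> edges (insert i K) ({} :: 'a set)" "Half i \<in> edges (insert i K) ({} :: 'a set)"
    by (auto simp: edges_def)
  ultimately show ?case
    using insert rk_insert[of "insert i K" "Half ` K" "{}" "Half i" g] by simp
qed simp

lemma dep_Half: "e \<in> edges K D \<Longrightarrow> dep g (Half ` K) e"
  by (cases e) (auto simp: dep_def)

text \<open>Every edge on \<open>K\<close> depends on the half edges of \<open>K\<close>, whose rank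
  is \<open>card K\<close>.\<close>

lemma rk_le_card:
  assumes "finite K" "finite S" "S \<subseteq> edges K D"
  shows "rk g S \<le> card K"
proof -
  have H: "finite (Half ` K :: 'a edge set)" "Half ` K \<subseteq> edges K D"
    using assms(1) by (auto simp: edges_def)
  have "rk g S \<le> rk g (S \<union> Half ` K)"
    using assms H by (intro rk_le_Un)
  also have "\<dots> = rk g (Half ` K \<union> S)"
    by (simp add: Un_commute)
  also have "\<dots> = rk g (Half ` K)"
    using assms H dep_Half by (intro rk_Un_dep) blast+
  finally show ?thesis
    using assms(1) by (simp add: rk_Half)
qed

text \<open>A solution of \<open>T\<close>, set to 0 outside \<open>L\<close>, also solves all edges
  on the disjoint set \<open>K\<close>.\<close>

lemma dep_Un_disjoint:
  assumes "S \<subseteq> edges K D" "T \<subseteq> edges L D" "K \<inter> L = {}" "e \<in> edges L D"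
  shows "dep g (S \<union> T) e \<longleftrightarrow> dep g T e"
proof
  assume dep: "dep g (S \<union> T) e"
  show "dep g T e"
    unfolding dep_def
  proof (intro allI impI)
    fix x assume x: "\<forall>s\<in>T. edge_form g s x = 0"
    define y where "y = (\<lambda>i. if i \<in> L then x i else 0)"
    have L: "edge_form g s y = edge_form g s x" if "s \<in> edges L D" for s
      using verts_subset[OF that] by (intro edge_form_cong) (auto simp: y_def)
    have "edge_form g s y = 0" if "s \<in> S" for s
    proof -
      have "edge_form g s y = edge_form g s (\<lambda>_. 0)"
        using that assms(1,3) verts_subset[of s K D]
        by (intro edge_form_cong) (auto simp: y_def)
      then show ?thesis
        by simp
    qed
    moreover have "edge_form g s y = 0" if "s \<in> T" for s
      using L x that assms(2) by (metis subsetD)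
    ultimately show "edge_form g e x = 0"
      using dep L[OF assms(4)] by (metis Un_iff dep_def)
  qed
qed (use dep_mono in blast)

lemma rk_Un_disjoint:
  assumes "finite T" "finite S" "finite K" "finite L"
    and "S \<subseteq> edges K D" "T \<subseteq> edges L D" "K \<inter> L = {}"
  shows "rk g (S \<union> T) = rk g S + rk g T"
  using assms
proof (induction T rule: finite_induct)
  case (insert e T)
  have "S \<union> T \<subseteq> edges (K \<union> L) D" "e \<in> edges (K \<union> L) D"
    using insert.prems edges_mono[of K "K \<union> L" D] edges_mono[of L "K \<union> L" D] by auto
  then have "rk g (insert e (S \<union> T)) = (if dep g (S \<union> T) e then rk g (S \<union> T) else Suc (rk g (S \<union> T)))"
    using insert by (intro rk_insert) auto
  moreover have "rk g (insert e T) = (if dep g T e then rk g T else Suc (rk g T))"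
    using insert by (intro rk_insert[of L _ D]) auto
  ultimately show ?case
    using insert dep_Un_disjoint[of S K D T L e g] by simp
qed simp

text \<open>Building \<open>S\<close> edge by edge, the rank counts the edges independent of the
  earlier ones, so it is determined by \<open>dep\<close>. All comparisons between different vertex
  sets or gains rest on this.\<close>

lemma rk_image_cong:
  assumes "finite S" "finite U" "finite U'" "S \<subseteq> edges U D" "h ` S \<subseteq> edges U' D'"
    and "\<And>T e. T \<subseteq> S \<Longrightarrow> e \<in> S \<Longrightarrow> dep g T e \<longleftrightarrow> dep g' (h ` T) (h e)"
  shows "rk g S = rk g' (h ` S)"
  using assms
proof (induction S rule: finite_induct)
  case (insert e S)
  have "rk g S = rk g' (h ` S)"
    using insert by (metis insert_subset image_insert insertCI subset_insertI2)
  moreover have "dep g S e \<longleftrightarrow> dep g' (h ` S) (h e)"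
    using insert.prems(5)[of S e] by blast
  ultimately show ?case
    using insert rk_insert[of U S D e g] rk_insert[of U' "h ` S" D' "h e" g'] by simp
qed simp

section \<open>The exponential structure\<close>

text \<open>Whitney's formula for the characteristic polynomial, summed over edge sets instead of
  sets of hyperplanes. All edge sets occur because the origin lies on every hyperplane.\<close>

definition whitney :: "('d \<Rightarrow> real) \<Rightarrow> 'd set \<Rightarrow> nat set \<Rightarrow> rat poly" where
  "whitney g D U = (\<Sum>S\<in>Pow (edges U D). monom ((-1) ^ card S) (card U - rk g S))"

text \<open>Expresses, without paths, that \<open>K\<close> is a union of connected components of
  the graph with edge set \<open>S\<close>.\<close>

definition separates :: "nat set \<Rightarrow> 'd edge set \<Rightarrow> bool" where
  "separates K S \<longleftrightarrow> (\<forall>e\<in>S. verts e \<subseteq> K \<or> verts e \<inter> K = {})"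

text \<open>The edge sets on \<open>K\<close> for which the component of \<open>v\<close> is all of \<open>K\<close>.\<close>

definition conn :: "'d set \<Rightarrow> nat \<Rightarrow> nat set \<Rightarrow> 'd edge set set" where
  "conn D v K = {S. S \<subseteq> edges K D \<and> (\<forall>L\<subseteq>K. v \<in> L \<and> separates L S \<longrightarrow> L = K)}"

text \<open>The weight \<kappa>(K) of the recursion. The base vertex \<open>v\<close> is only a
  means of stating connectedness: for nonzero gains and \<open>v\<close> in \<open>K\<close>, the
  formula in \<open>conn_poly_eq\<close> does not mention it.\<close>

definition conn_poly :: "('d \<Rightarrow> real) \<Rightarrow> 'd set \<Rightarrow> nat \<Rightarrow> nat set \<Rightarrow> rat poly" where
  "conn_poly g D v K = (\<Sum>S\<in>conn D v K. monom ((-1) ^ card S) (card K - rk g S))"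

lemma edges_verts_disjoint:
  "e \<in> edges (U - K) D \<longleftrightarrow> e \<in> edges U D \<and> verts e \<inter> K = {}"
  by (cases e) auto

text \<open>An edge set on \<open>U\<close> determines the component \<open>K\<close> of
  \<open>v\<close>, and splits into its edges inside \<open>K\<close> and its edges avoiding
  \<open>K\<close>.\<close>

lemma bij_betw_conn_split:
  assumes "finite U" "v \<in> U"
  shows "bij_betw (\<lambda>(K, S, T). S \<union> T)
    (SIGMA K : {K. K \<subseteq> U \<and> v \<in> K}. conn D v K \<times> Pow (edges (U - K) D)) (Pow (edges U D))"
    (is "bij_betw ?f ?A ?B")
proof -
  have parts: "K \<subseteq> U" "v \<in> K" "S \<subseteq> edges K D" "T \<subseteq> edges (U - K) D"
    "separates K (S \<union> T)" "\<And>L. L \<subseteq> K \<Longrightarrow> v \<in> L \<Longrightarrow> separates L (S \<union> T) \<Longrightarrow> L = K"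
    "S = {e \<in> S \<union> T. verts e \<subseteq> K}" "T = {e \<in> S \<union> T. verts e \<inter> K = {}}"
    if "(K, S, T) \<in> ?A" for K S T
  proof -
    show *: "K \<subseteq> U" "v \<in> K" "S \<subseteq> edges K D" "T \<subseteq> edges (U - K) D"
      using that by (auto simp: conn_def)
    have S: "verts e \<subseteq> K" if "e \<in> S" for e
      using * that verts_subset[of e K D] by blast
    have T: "verts e \<inter> K = {}" if "e \<in> T" for e
      using * that edges_verts_disjoint[of e U K D] by blast
    show "separates K (S \<union> T)"
      using S T by (auto simp: separates_def)
    show "L = K" if "L \<subseteq> K" "v \<in> L" "separates L (S \<union> T)" for L
      using \<open>(K, S, T) \<in> ?A\<close> that by (auto simp: conn_def separates_def)
    show "S = {e \<in> S \<union> T. verts e \<subseteq> K}"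
      using S T verts_nonempty by blast
    show "T = {e \<in> S \<union> T. verts e \<inter> K = {}}"
      using S T verts_nonempty by blast
  qed
  have "inj_on ?f ?A"
  proof (rule inj_onI)
    fix p q assume pq: "p \<in> ?A" "q \<in> ?A" "?f p = ?f q"
    obtain K S T K' S' T' where [simp]: "p = (K, S, T)" "q = (K', S', T')"
      by (cases p, cases q)
    have A: "(K, S, T) \<in> ?A" "(K', S', T') \<in> ?A" and eq: "S \<union> T = S' \<union> T'"
      using pq by simp_all
    \<comment> \<open>Unions of components are closed under intersection, so minimality of
      \<open>K\<close> and of \<open>K'\<close> forces both to equal
      \<open>K \<inter> K'\<close>.\<close>
    have sep: "separates (K \<inter> K') (S \<union> T)"
      using parts(5)[OF A(1)] parts(5)[OF A(2)] unfolding eq separates_def by blast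
    have "v \<in> K \<inter> K'"
      using parts(2)[OF A(1)] parts(2)[OF A(2)] by blast
    then have "K \<inter> K' = K" "K \<inter> K' = K'"
      using parts(6)[OF A(1) Int_lower1 _ sep] parts(6)[OF A(2) Int_lower2 _ sep[unfolded eq]]
      by blast+
    then have "K = K'"
      by blast
    moreover have "S = S'"
      by (subst parts(7)[OF A(1)], subst parts(7)[OF A(2)]) (simp only: eq \<open>K = K'\<close>)
    moreover have "T = T'"
      by (subst parts(8)[OF A(1)], subst parts(8)[OF A(2)]) (simp only: eq \<open>K = K'\<close>)
    ultimately show "p = q"
      by simp
  qed
  moreover have "?f ` ?A = ?B"
  proof
    show "?f ` ?A \<subseteq> ?B"
    proof
      fix R assume "R \<in> ?f ` ?A"
      then obtain K S T where A: "(K, S, T) \<in> ?A" and R: "R = S \<union> T"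
        by auto
      have "S \<union> T \<subseteq> edges U D"
        using parts(1,3,4)[OF A] edges_mono[of K U D] edges_mono[of "U - K" U D] by blast
      then show "R \<in> ?B"
        by (simp add: R)
    qed
    show "?B \<subseteq> ?f ` ?A"
    proof
      fix S assume "S \<in> ?B"
      then have S: "S \<subseteq> edges U D"
        by blast
      \<comment> \<open>The component of \<open>v\<close> is the intersection of all separated sets
        containing \<open>v\<close>.\<close>
      define \<K> where "\<K> = {K. K \<subseteq> U \<and> v \<in> K \<and> separates K S}"
      define K where "K = \<Inter>\<K>"
      have "U \<in> \<K>"
        using S assms(2) verts_subset[of _ U D] by (auto simp: \<K>_def separates_def)
      then have KU: "K \<subseteq> U" and vK: "v \<in> K"
        by (auto simp: K_def \<K>_def)
      have sep: "separates K S"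
        unfolding separates_def
      proof
        fix e assume "e \<in> S"
        then have "\<forall>L\<in>\<K>. verts e \<subseteq> L \<or> verts e \<inter> L = {}"
          by (auto simp: \<K>_def separates_def)
        then show "verts e \<subseteq> K \<or> verts e \<inter> K = {}"
          unfolding K_def by blast
      qed
      define S1 where "S1 = {e\<in>S. verts e \<subseteq> K}"
      define S2 where "S2 = {e\<in>S. verts e \<inter> K = {}}"
      have "S = S1 \<union> S2"
        using sep by (auto simp: S1_def S2_def separates_def)
      moreover have "S2 \<subseteq> edges (U - K) D"
        using S by (auto simp: S2_def edges_verts_disjoint)
      moreover have "S1 \<in> conn D v K"
      proof -
        have "L = K" if L: "L \<subseteq> K" "v \<in> L" "separates L S1" for L
        proof -
          have "separates L S"
            unfolding \<open>S = S1 \<union> S2\<close> using L by (auto simp: separates_def S2_def)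
          then have "L \<in> \<K>"
            using L KU by (auto simp: \<K>_def)
          then show ?thesis
            using L by (auto simp: K_def)
        qed
        then show ?thesis
          using S by (auto simp: conn_def S1_def edges_iff_verts[OF KU])
      qed
      ultimately show "S \<in> ?f ` ?A"
        using KU vK by (intro image_eqI[of _ _ "(K, S1, S2)"]) auto
    qed
  qed
  ultimately show ?thesis
    by (simp add: bij_betw_def)
qed

lemma finite_conn: "finite K \<Longrightarrow> finite D \<Longrightarrow> finite (conn D v K)"
  using finite_edges[of K D] by (auto simp: conn_def intro: finite_subset[of _ "Pow (edges K D)"])

text \<open>Cardinality and rank both add over the two vertex-disjoint pieces of the splitting, so
  each monomial factors.\<close>

lemma whitney_rec:
  assumes "finite U" "finite D" "v \<in> U"
  shows "whitney g D U = (\<Sum>K\<in>{K. K \<subseteq> U \<and> v \<in> K}. conn_poly g D v K * whitney g D (U - K))"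
proof -
  let ?m = "\<lambda>U S. monom ((-1 :: rat) ^ card S) (card U - rk g S)"
  let ?A = "SIGMA K : {K. K \<subseteq> U \<and> v \<in> K}. conn D v K \<times> Pow (edges (U - K) D)"
  have split: "?m U (S \<union> T) = ?m K S * ?m (U - K) T"
    if K: "K \<subseteq> U" and ST: "S \<subseteq> edges K D" "T \<subseteq> edges (U - K) D" for K S T
  proof -
    have fin: "finite K" "finite (U - K)" "finite S" "finite T"
      using assms K ST finite_edges[of _ D] by (auto dest: finite_subset)
    have "S \<inter> T = {}"
      using ST verts_subset[of _ K D] edges_verts_disjoint[of _ U K D] verts_nonempty
      by blast
    moreover have "rk g (S \<union> T) = rk g S + rk g T"
      using fin ST by (intro rk_Un_disjoint) auto
    moreover have "card U = card K + card (U - K)"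
      using K assms(1) by (metis card_Diff_subset card_mono fin(1) le_add_diff_inverse)
    \<comment> \<open>These bounds let the truncated subtractions in the exponents add up.\<close>
    moreover have "rk g S \<le> card K" "rk g T \<le> card (U - K)"
      using fin ST rk_le_card by blast+
    ultimately show ?thesis
      using fin by (simp add: card_Un_disjoint mult_monom power_add)
  qed
  have "whitney g D U = (\<Sum>(K, S, T)\<in>?A. ?m U (S \<union> T))"
    unfolding whitney_def
    by (subst sum.reindex_bij_betw[OF bij_betw_conn_split[OF assms(1,3), of D], symmetric])
       (simp add: case_prod_unfold)
  also have "\<dots> = (\<Sum>(K, S, T)\<in>?A. ?m K S * ?m (U - K) T)"
    by (rule sum.cong) (auto simp: split conn_def simp del: mult_monom)
  also have "\<dots> = (\<Sum>K\<in>{K. K \<subseteq> U \<and> v \<in> K}. \<Sum>(S, T)\<in>conn D v K \<times> Pow (edges (U - K) D).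
      ?m K S * ?m (U - K) T)"
    using assms
    by (subst sum.Sigma)
       (auto intro!: sum.cong finite_conn finite_edges intro: finite_subset[of _ U])
  also have "\<dots> = (\<Sum>K\<in>{K. K \<subseteq> U \<and> v \<in> K}. conn_poly g D v K * whitney g D (U - K))"
    unfolding conn_poly_def whitney_def sum_product sum.cartesian_product ..
  finally show ?thesis .
qed

section \<open>The connected part is a multiple of \<open>t - 1\<close>\<close>

lemma card_le_Suc_rk_conn:
  assumes "finite K" "finite D" "v \<in> K" "S \<in> conn D v K" "\<And>d. d \<in> D \<Longrightarrow> g d \<noteq> 0"
  shows "card K \<le> Suc (rk g S)"
proof -
  have S: "S \<subseteq> edges K D" "finite S"
    using assms finite_edges[of K D] by (auto simp: conn_def intro: finite_subset)
  have H: "Half ` K \<subseteq> edges K D" "finite (Half ` K :: 'a edge set)"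
    using assms(1) by auto
  have "dep g (insert (Half v) S) (Half i)" if "i \<in> K" for i
    unfolding dep_def
  proof (intro allI impI)
    fix x assume x: "\<forall>s\<in>insert (Half v) S. edge_form g s x = 0"
    \<comment> \<open>A link with nonzero gain has both ends in the zero set of a solution or
      neither, so no edge leaves \<open>L\<close>, and connectedness spreads the zero at
      \<open>v\<close> to all of \<open>K\<close>.\<close>
    define L where "L = {i\<in>K. x i = 0}"
    have "separates L S"
      unfolding separates_def
    proof
      fix e assume "e \<in> S"
      then have "e \<in> edges K D" "edge_form g e x = 0"
        using S x by auto
      then show "verts e \<subseteq> L \<or> verts e \<inter> L = {}"
        using assms(5) by (cases e) (auto simp: L_def)
    qed
    then have "L = K"
      using assms(3,4) x by (auto simp: conn_def L_def)
    then show "edge_form g (Half i) x = 0"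
      using that by (auto simp: L_def)
  qed
  then have "rk g (insert (Half v) S \<union> Half ` K) = rk g (insert (Half v) S)"
    using S H assms by (intro rk_Un_dep[of _ K _ D]) auto
  also have "\<dots> \<le> Suc (rk g S)"
    using S assms rk_insert[of K S D "Half v" g] by simp
  finally have "rk g (insert (Half v) S \<union> Half ` K) \<le> Suc (rk g S)" .
  moreover have "rk g (Half ` K) \<le> rk g (Half ` K \<union> insert (Half v) S)"
    using S H assms by (intro rk_le_Un[of _ K _ D]) auto
  ultimately show ?thesis
    using assms(1) by (simp add: rk_Half Un_commute)
qed

lemma whitney_empty [simp]: "whitney g D {} = 1"
proof -
  have "edges {} D = {}"
    by (auto simp: edges_def)
  then show ?thesis
    by (simp add: whitney_def monom_0)
qed

text \<open>At 1 only the signs \<open>(-1) ^ card S\<close> remain, and they cancel under adding or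
  removing one half edge.\<close>

lemma poly_whitney_1:
  assumes "finite U" "finite D" "U \<noteq> {}"
  shows "poly (whitney g D U) 1 = 0"
proof -
  obtain v where "v \<in> U"
    using assms(3) by blast
  define E where "E = edges U D - {Half v}"
  have E: "edges U D = insert (Half v) E" "Half v \<notin> E" "finite E"
    using \<open>v \<in> U\<close> finite_edges[OF assms(1,2)] by (auto simp: E_def)
  have "card (insert (Half v) S) = Suc (card S)" if "S \<in> Pow E" for S
    using that E by (meson card_insert_disjoint finite_subset PowD subsetD)
  then have "(\<Sum>S\<in>Pow (edges U D). (-1 :: rat) ^ card S) = 0"
    unfolding E(1) sum_Pow_insert[OF E(3,2)] by (simp add: sum_negf)
  then show ?thesis
    by (simp add: whitney_def poly_sum poly_monom)
qed

lemma poly_whitney_Diff_1: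
  assumes "finite U" "finite D" "K \<subseteq> U"
  shows "poly (whitney g D (U - K)) 1 = (if K = U then 1 else 0)"
  using assms poly_whitney_1[of "U - K" D g] by auto

lemma pderiv_sum: "pderiv (\<Sum>i\<in>A. f i) = (\<Sum>i\<in>A. pderiv (f i))"
  by (induction A rule: infinite_finite_induct) (auto simp: pderiv_add)

text \<open>Each connected edge set on \<open>K\<close> has rank \<open>card K\<close> or \<open>card K - 1\<close>, and the polynomial
  vanishes at 1 because the Whitney polynomial of a nonempty central arrangement does.\<close>

lemma conn_poly_eq:
  assumes "finite K" "finite D" "v \<in> K" "\<And>d. d \<in> D \<Longrightarrow> g d \<noteq> 0"
  shows "conn_poly g D v K = smult (poly (pderiv (whitney g D K)) 1) [:-1, 1:]"
proof -
  let ?\<K> = "{L. L \<subseteq> K \<and> v \<in> L}"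
  have fin: "finite ?\<K>"
    using assms(1) by simp
  have linear: "conn_poly g D v L = smult (coeff (conn_poly g D v L) 1) [:-1, 1:]"
    if L: "finite L" "v \<in> L" for L
  proof -
    let ?p = "conn_poly g D v L"
    have "degree ?p \<le> 1"
      unfolding conn_poly_def
    proof (intro degree_sum_le)
      fix S assume "S \<in> conn D v L"
      then have "card L - rk g S \<le> 1"
        using card_le_Suc_rk_conn[OF L(1) assms(2) L(2), of S g] assms(4) by fastforce
      then show "degree (monom ((-1 :: rat) ^ card S) (card L - rk g S)) \<le> 1"
        using degree_monom_le le_trans by blast
    qed (use L(1) assms(2) finite_conn in blast)
    \<comment> \<open>At 1 the recursion collapses to the term of \<open>L\<close> itself, while its
      left side is 0.\<close>
    moreover have "poly ?p 1 = 0"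
    proof -
      have "0 = (\<Sum>M\<in>{M. M \<subseteq> L \<and> v \<in> M}. poly (conn_poly g D v M * whitney g D (L - M)) 1)"
        using poly_whitney_1[of L D g] L assms(2) whitney_rec[of L D v g] by (auto simp: poly_sum)
      also have "\<dots> = (\<Sum>M\<in>{M. M \<subseteq> L \<and> v \<in> M}. if M = L then poly (conn_poly g D v M) 1 else 0)"
        using L assms(2) by (intro sum.cong) (auto simp: poly_whitney_Diff_1)
      also have "\<dots> = poly ?p 1"
        using L by simp
      finally show ?thesis
        by simp
    qed
    moreover have "?p = [:coeff ?p 0, coeff ?p 1:]"
      using \<open>degree ?p \<le> 1\<close> by (intro poly_eqI) (auto simp: coeff_pCons coeff_eq_0 split: nat.split)
    then obtain c d where "?p = [:c, d:]"
      by blast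
    ultimately show ?thesis
      by (simp add: add_eq_0_iff2)
  qed
  \<comment> \<open>In the product rule at 1, the term differentiating the Whitney factor dies
    because \<open>conn_poly\<close> has the root 1; the other term survives only for
    \<open>L = K\<close>.\<close>
  have "poly (pderiv (whitney g D K)) 1 =
      (\<Sum>L\<in>?\<K>. poly (pderiv (conn_poly g D v L * whitney g D (K - L))) 1)"
    using assms by (simp add: whitney_rec[of K D v g] pderiv_sum poly_sum)
  also have "\<dots> = (\<Sum>L\<in>?\<K>. if L = K then coeff (conn_poly g D v L) 1 else 0)"
  proof (rule sum.cong)
    fix L assume L: "L \<in> ?\<K>"
    then have "conn_poly g D v L = smult (coeff (conn_poly g D v L) 1) [:-1, 1:]"
      using assms(1) linear finite_subset by blast
    then obtain c where c: "conn_poly g D v L = smult c [:-1, 1:]" "c = coeff (conn_poly g D v L) 1"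
      by blast
    show "poly (pderiv (conn_poly g D v L * whitney g D (K - L))) 1 =
        (if L = K then coeff (conn_poly g D v L) 1 else 0)"
      unfolding c(2)[symmetric] unfolding c(1) pderiv_mult poly_add poly_mult
      using L assms(1,2) by (simp add: pderiv_smult pderiv_pCons poly_whitney_Diff_1)
  qed simp
  also have "\<dots> = coeff (conn_poly g D v K) 1"
    using fin assms by simp
  finally show ?thesis
    using linear[OF assms(1,3)] by simp
qed

section \<open>Relabelling, and the recursion in the number of vertices\<close>

lemma whitney_cong:
  assumes "finite U" "finite U'" "finite D" "finite D'" "card U = card U'"
    and bij: "bij_betw h (edges U D) (edges U' D')"
    and dep: "\<And>T e. T \<subseteq> edges U D \<Longrightarrow> e \<in> edges U D \<Longrightarrow> dep g T e \<longleftrightarrow> dep g' (h ` T) (h e)"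
  shows "whitney g D U = whitney g' D' U'"
proof -
  have "card (h ` S) = card S" "rk g' (h ` S) = rk g S" if "S \<subseteq> edges U D" for S
  proof -
    show "card (h ` S) = card S"
      using bij that by (meson bij_betw_def card_image inj_on_subset)
    have "h ` S \<subseteq> edges U' D'"
      using bij that by (auto simp: bij_betw_def)
    moreover have "finite S"
      using that finite_edges[OF assms(1,3)] finite_subset by blast
    ultimately show "rk g' (h ` S) = rk g S"
      using that assms(1,2) by (intro rk_image_cong[symmetric] dep) auto
  qed
  then have "whitney g D U =
      (\<Sum>S\<in>Pow (edges U D). monom ((-1) ^ card (h ` S)) (card U' - rk g' (h ` S)))"
    unfolding whitney_def assms(5) by (intro sum.cong) auto
  also have "\<dots> = whitney g' D' U'"
    unfolding whitney_def by (rule sum.reindex_bij_betw[OF bij_betw_Pow[OF bij]])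
  finally show ?thesis .
qed

text \<open>Applied with \<open>k = id\<close> to renumber vertices and with \<open>f = id\<close>
  to exchange gain sets.\<close>

fun relabel :: "(nat \<Rightarrow> nat) \<Rightarrow> ('d \<Rightarrow> 'c) \<Rightarrow> 'd edge \<Rightarrow> 'c edge" where
  "relabel f k (Half i) = Half (f i)"
| "relabel f k (Link i j d) = Link (f i) (f j) (k d)"

lemma relabel_edges:
  assumes "bij_betw f U U'" "bij_betw k D D'"
  shows "relabel f k ` edges U D \<subseteq> edges U' D'"
proof
  fix e' assume "e' \<in> relabel f k ` edges U D"
  then obtain e where "e \<in> edges U D" "e' = relabel f k e"
    by blast
  then show "e' \<in> edges U' D'"
    using bij_betw_apply[OF assms(1)] bij_betw_apply[OF assms(2)]
      inj_on_eq_iff[OF bij_betw_imp_inj_on[OF assms(1)]]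
    by (cases e) auto
qed

lemma bij_betw_relabel:
  assumes f: "bij_betw f U U'" and k: "bij_betw k D D'"
  shows "bij_betw (relabel f k) (edges U D) (edges U' D')"
proof (rule bij_betw_byWitness[where f' = "relabel (inv_into U f) (inv_into D k)"])
  note inv = bij_betw_inv_into_left[OF f] bij_betw_inv_into_left[OF k]
    bij_betw_inv_into_right[OF f] bij_betw_inv_into_right[OF k]
  show "\<forall>e\<in>edges U D. relabel (inv_into U f) (inv_into D k) (relabel f k e) = e"
    by (auto simp: edges_def inv)
  show "\<forall>e\<in>edges U' D'. relabel f k (relabel (inv_into U f) (inv_into D k) e) = e"
    by (auto simp: edges_def inv)
  show "relabel f k ` edges U D \<subseteq> edges U' D'"
    using f k by (rule relabel_edges)
  show "relabel (inv_into U f) (inv_into D k) ` edges U' D' \<subseteq> edges U D"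
    using f k by (intro relabel_edges bij_betw_inv_into)
qed

lemma edge_form_relabel: "edge_form g (relabel f k e) x = edge_form (g \<circ> k) e (x \<circ> f)"
  by (cases e) auto

lemma whitney_card_cong:
  assumes "finite U" "finite U'" "finite D" "card U = card U'"
  shows "whitney g D U = whitney g D U'"
proof -
  obtain f where f: "bij_betw f U U'"
    using finite_same_card_bij assms by blast
  have "dep g T e \<longleftrightarrow> dep g (relabel f id ` T) (relabel f id e)"
    if T: "T \<subseteq> edges U D" "e \<in> edges U D" for T e
  proof
    assume "dep g T e"
    then show "dep g (relabel f id ` T) (relabel f id e)"
      by (auto simp: dep_def edge_form_relabel)
  next
    assume dep: "dep g (relabel f id ` T) (relabel f id e)"
    show "dep g T e"
      unfolding dep_def
    proof (intro allI impI)
      fix x assume x: "\<forall>s\<in>T. edge_form g s x = 0"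
      \<comment> \<open>Solutions move to \<open>U'\<close> along the inverse of \<open>f\<close>;
        an edge only reads coordinates in \<open>U\<close>, so the other values are
        harmless.\<close>
      define y where "y = x \<circ> inv_into U f"
      have "edge_form g (relabel f id s) y = edge_form g s x" if "s \<in> edges U D" for s
        unfolding edge_form_relabel comp_id using verts_subset[OF that] f
        by (intro edge_form_cong) (auto simp: y_def bij_betw_def)
      moreover from this have "\<forall>s\<in>relabel f id ` T. edge_form g s y = 0"
        using x T(1) by auto
      ultimately show "edge_form g e x = 0"
        using dep T(2) by (metis dep_def)
    qed
  qed
  then show ?thesis
    using assms by (intro whitney_cong[OF _ _ _ _ _ bij_betw_relabel[OF f bij_betw_id]]) auto
qed

lemma sum_Pow_card:
  fixes f :: "nat \<Rightarrow> 'a :: comm_semiring_1"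
  assumes "finite A"
  shows "(\<Sum>K\<in>Pow A. f (card K)) = (\<Sum>k\<le>card A. of_nat (card A choose k) * f k)"
proof -
  have "(\<Sum>K\<in>Pow A. f (card K)) = (\<Sum>k\<le>card A. \<Sum>K\<in>{K\<in>Pow A. card K = k}. f (card K))"
    using assms by (intro sum.group[symmetric]) (auto intro: card_mono)
  also have "\<dots> = (\<Sum>k\<le>card A. of_nat (card A choose k) * f k)"
  proof (rule sum.cong)
    fix k
    have "(\<Sum>K\<in>{K\<in>Pow A. card K = k}. f (card K)) = (\<Sum>K\<in>{K. K \<subseteq> A \<and> card K = k}. f k)"
      by (rule sum.cong) auto
    then show "(\<Sum>K\<in>{K\<in>Pow A. card K = k}. f (card K)) = of_nat (card A choose k) * f k"
      using n_subsets[OF assms, of k] by simp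
  qed simp
  finally show ?thesis .
qed

text \<open>The component of the last vertex \<open>n\<close> has \<open>k\<close> further vertices,
  and only their number matters. Coefficientwise this is the differential equation
  \<open>X' = (t - 1) B X\<close>.\<close>

lemma whitney_Suc:
  fixes g :: "'d \<Rightarrow> real"
  assumes "finite D" "\<And>d. d \<in> D \<Longrightarrow> g d \<noteq> 0"
  defines "W \<equiv> \<lambda>n. whitney g D {..<n}"
  shows "W (Suc n) = (\<Sum>k\<le>n. of_nat (n choose k) *
    (smult (poly (pderiv (W (Suc k))) 1) [:-1, 1:] * W (n - k)))"
proof -
  let ?f = "\<lambda>k. smult (poly (pderiv (W (Suc k))) 1) [:-1, 1:] * W (n - k)"
  have bij: "bij_betw (insert n) (Pow {..<n}) {K. K \<subseteq> {..<Suc n} \<and> n \<in> K}"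
    by (rule bij_betw_byWitness[where f' = "\<lambda>K. K - {n}"]) (auto simp: less_Suc_eq)
  have "W (Suc n) = (\<Sum>K\<in>{K. K \<subseteq> {..<Suc n} \<and> n \<in> K}. conn_poly g D n K * whitney g D ({..<Suc n} - K))"
    unfolding W_def using assms by (intro whitney_rec) auto
  also have "\<dots> = (\<Sum>K\<in>Pow {..<n}. conn_poly g D n (insert n K) * whitney g D ({..<Suc n} - insert n K))"
    by (rule sum.reindex_bij_betw[OF bij, symmetric])
  also have "\<dots> = (\<Sum>K\<in>Pow {..<n}. ?f (card K))"
  proof (rule sum.cong)
    fix K assume "K \<in> Pow {..<n}"
    then have K: "finite K" "n \<notin> K" "K \<subseteq> {..<n}"
      using finite_subset by auto
    have "whitney g D ({..<Suc n} - insert n K) = W (n - card K)"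
    proof -
      have "{..<Suc n} - insert n K = {..<n} - K"
        by (auto simp: less_Suc_eq)
      then show ?thesis
        unfolding W_def using K assms by (intro whitney_card_cong) (auto simp: card_Diff_subset)
    qed
    moreover have "whitney g D (insert n K) = W (Suc (card K))"
      unfolding W_def using K assms by (intro whitney_card_cong) auto
    ultimately show "conn_poly g D n (insert n K) * whitney g D ({..<Suc n} - insert n K) = ?f (card K)"
      using conn_poly_eq[of "insert n K" D n g] K assms by simp
  qed simp
  also have "\<dots> = (\<Sum>k\<le>n. of_nat (n choose k) * ?f k)"
    using sum_Pow_card[of "{..<n}" ?f] by simp
  finally show ?thesis .
qed

section \<open>Exponentials of formal power series\<close>

unbundle no vec_syntax and fps_syntax

text \<open>Comparing coefficients expresses \<open>n\<close> times the \<open>n\<close>-th one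
  through earlier ones, and \<open>n\<close> can be cancelled in characteristic 0.\<close>

lemma fps_ode_unique:
  fixes A X Y :: "'a :: {idom, ring_char_0} fps"
  assumes "fps_deriv X = A * X" "fps_deriv Y = A * Y" "X $ 0 = Y $ 0"
  shows "X = Y"
proof (rule fps_ext)
  fix n show "X $ n = Y $ n"
  proof (induction n rule: less_induct)
    case (less n)
    show ?case
    proof (cases n)
      case (Suc m)
      have "of_nat n * Z $ n = (\<Sum>i=0..m. A $ i * Z $ (m - i))" if "fps_deriv Z = A * Z" for Z
        using arg_cong[OF that, of "\<lambda>F. F $ m"] by (simp add: fps_mult_nth Suc)
      then have "of_nat n * X $ n = (\<Sum>i=0..m. A $ i * X $ (m - i))"
        "of_nat n * Y $ n = (\<Sum>i=0..m. A $ i * Y $ (m - i))"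
        using assms by blast+
      moreover have "(\<Sum>i=0..m. A $ i * X $ (m - i)) = (\<Sum>i=0..m. A $ i * Y $ (m - i))"
        using less Suc by (intro sum.cong) auto
      ultimately have "of_nat n * X $ n = of_nat n * Y $ n"
        by simp
      then show ?thesis
        using Suc mult_cancel_left of_nat_eq_0_iff by blast
    qed (use assms in simp)
  qed
qed

text \<open>Written as compositions, the exponential and the logarithm can be differentiated by the
  chain rule.\<close>

lemma fps_exp0_eq: "fps_exp0 G = Abs_fps (\<lambda>k. [:1 / fact k:]) oo G"
  by (simp add: fps_eq_iff fps_exp0_def fps_compose_nth atLeast0AtMost)

lemma fps_log1_eq:
  "fps_log1 F = Abs_fps (\<lambda>k. if k = 0 then 0 else [:(-1) ^ (k + 1) / of_nat k:]) oo (F - 1)"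
proof -
  have "(\<Sum>k\<in>{1..n}. smult ((-1) ^ (k + 1) / of_nat k) ((F - 1) ^ k $ n)) =
    (\<Sum>k=0..n. (if k = 0 then 0 else [:(-1) ^ (k + 1) / of_nat k:]) * (F - 1) ^ k $ n)" for n
    by (rule sum.mono_neutral_cong_left) auto
  then show ?thesis
    by (simp add: fps_eq_iff fps_log1_def fps_compose_nth)
qed

lemma fps_deriv_exp0:
  assumes "G $ 0 = 0"
  shows "fps_deriv (fps_exp0 G) = fps_deriv G * fps_exp0 G"
proof -
  let ?E = "Abs_fps (\<lambda>k. [:1 / fact k:]) :: rat poly fps"
  have "fps_deriv ?E = ?E"
    by (rule fps_ext) (simp add: of_nat_poly del: of_nat_Suc)
  then show ?thesis
    using fps_compose_deriv[OF assms, of ?E] by (simp add: fps_exp0_eq mult.commute)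
qed

lemma fps_deriv_log1:
  assumes "F $ 0 = 1"
  shows "F * fps_deriv (fps_log1 F) = fps_deriv F"
proof -
  let ?L = "Abs_fps (\<lambda>k. if k = 0 then 0 else [:(-1) ^ (k + 1) / of_nat k:]) :: rat poly fps"
  have F: "(F - 1) $ 0 = 0"
    using assms by simp
  have nth: "fps_deriv ?L $ n = [:(-1) ^ n:]" for n
    by (simp add: of_nat_poly field_simps)
  \<comment> \<open>The derivative of the outer series is the geometric series of
    \<open>1 / (1 + X)\<close>.\<close>
  have "(1 + fps_X) * fps_deriv ?L = 1"
  proof (rule fps_ext)
    fix n show "((1 + fps_X) * fps_deriv ?L) $ n = 1 $ n"
      unfolding distrib_right fps_add_nth mult_1_left fps_X_mult_nth nth
      by (cases n) (simp_all add: one_pCons)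
  qed
  then have "((1 + fps_X) * fps_deriv ?L) oo (F - 1) = 1"
    by simp
  then have "F * (fps_deriv ?L oo (F - 1)) = 1"
    unfolding fps_compose_mult_distrib[OF F] fps_compose_add_distrib
    using F by (simp add: fps_X_fps_compose_startby0)
  moreover have "fps_deriv (fps_log1 F) = (fps_deriv ?L oo (F - 1)) * fps_deriv F"
    unfolding fps_log1_eq using fps_compose_deriv[OF F, of ?L] by simp
  ultimately show ?thesis
    by (simp flip: mult.assoc)
qed

text \<open>The logarithmic derivative of the power is \<open>\<alpha>\<close> times that of
  \<open>F\<close>, multiplied through by \<open>F\<close> to avoid division.\<close>

lemma fps_powr_poly_ode:
  assumes "F $ 0 = 1"
  shows "F * fps_deriv (fps_powr_poly F \<alpha>) = fps_const \<alpha> * fps_deriv F * fps_powr_poly F \<alpha>"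
proof -
  have "(fps_const \<alpha> * fps_log1 F) $ 0 = 0"
    by (simp add: fps_log1_def)
  then have "fps_deriv (fps_powr_poly F \<alpha>) = fps_const \<alpha> * fps_deriv (fps_log1 F) * fps_powr_poly F \<alpha>"
    unfolding fps_powr_poly_def by (simp add: fps_deriv_exp0)
  then have "F * fps_deriv (fps_powr_poly F \<alpha>) =
      fps_const \<alpha> * (F * fps_deriv (fps_log1 F)) * fps_powr_poly F \<alpha>"
    by (simp add: mult_ac)
  then show ?thesis
    using assms by (simp add: fps_deriv_log1)
qed

lemma fps_powr_poly_nth_0 [simp]: "fps_powr_poly F \<alpha> $ 0 = 1"
  by (simp add: fps_powr_poly_def fps_exp0_def one_pCons)

section \<open>Exponential generating functions\<close>

definition egf :: "(nat \<Rightarrow> rat poly) \<Rightarrow> rat poly fps" where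
  "egf f = Abs_fps (\<lambda>n. smult (1 / fact n) (f n))"

lemma egf_nth [simp]: "egf f $ n = smult (1 / fact n) (f n)"
  by (simp add: egf_def)

lemma fps_deriv_egf: "fps_deriv (egf f) = egf (\<lambda>n. f (Suc n))"
  by (rule fps_ext) (simp add: of_nat_poly field_simps del: of_nat_Suc)

lemma egf_mult: "egf f * egf h = egf (\<lambda>n. \<Sum>k\<le>n. of_nat (n choose k) * (f k * h (n - k)))"
proof (rule fps_ext)
  fix n
  have smult_sum: "smult c (\<Sum>k\<le>n. p k) = (\<Sum>k\<le>n. smult c (p k))" for c and p :: "nat \<Rightarrow> rat poly"
    by (induction n) (simp_all add: smult_add_right)
  show "(egf f * egf h) $ n = egf (\<lambda>n. \<Sum>k\<le>n. of_nat (n choose k) * (f k * h (n - k))) $ n"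
    unfolding fps_mult_nth egf_nth smult_sum atLeast0AtMost
    by (rule sum.cong) (simp_all add: of_nat_poly binomial_fact mult.commute)
qed

lemma egf_eq_powr:
  fixes W :: "nat \<Rightarrow> rat poly"
  assumes W0: "W 0 = 1"
    and rec: "\<And>n. W (Suc n) = (\<Sum>k\<le>n. of_nat (n choose k) * (smult (\<beta> k) [:-1, 1:] * W (n - k)))"
  shows "egf W = fps_powr_poly (egf (\<lambda>n. [:poly (W n) (-1):])) [:1/2, -1/2:]"
proof -
  let ?X = "egf W" and ?F = "egf (\<lambda>n. [:poly (W n) (-1):])"
  let ?Y = "fps_powr_poly ?F [:1/2, -1/2:]"
  let ?B = "egf (\<lambda>k. [:\<beta> k:])"
  have F0: "?F $ 0 = 1"
    by (simp add: W0 one_pCons)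
  have X: "fps_deriv ?X = fps_const [:-1, 1:] * ?B * ?X"
  proof -
    have "fps_const [:-1, 1:] * ?B = egf (\<lambda>k. smult (\<beta> k) [:-1, 1:])"
      by (rule fps_ext) simp
    then show ?thesis
      by (simp add: fps_deriv_egf egf_mult rec)
  qed
  \<comment> \<open>Evaluation at -1 turns the factor \<open>t - 1\<close> into -2 and leaves
    \<open>?B\<close> unchanged.\<close>
  have F: "fps_deriv ?F = fps_const [:-2:] * ?B * ?F"
  proof -
    have "fps_const [:-2:] * ?B = egf (\<lambda>k. [:-2 * \<beta> k:])"
      by (rule fps_ext) simp
    moreover have "[:poly (W (Suc n)) (-1):] =
        (\<Sum>k\<le>n. of_nat (n choose k) * ([:-2 * \<beta> k:] * [:poly (W (n - k)) (-1):]))" for n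
      by (simp add: rec poly_sum of_nat_poly sum_to_poly mult_ac)
    ultimately show ?thesis
      by (simp add: fps_deriv_egf egf_mult)
  qed
  have "?F * fps_deriv ?Y = fps_const [:1/2, -1/2:] * (fps_const [:-2:] * ?B * ?F) * ?Y"
    using fps_powr_poly_ode[OF F0] unfolding F .
  also have "\<dots> = ?F * ((fps_const ([:1/2, -1/2:] * [:-2:]) * ?B) * ?Y)"
    unfolding fps_const_mult[symmetric] by (simp only: mult_ac)
  \<comment> \<open>The exponent is \<open>(1 - t) / 2\<close>, whose product with -2 is
    \<open>t - 1\<close>; the nonzero factor \<open>?F\<close> is cancelled.\<close>
  finally have Y: "fps_deriv ?Y = fps_const [:-1, 1:] * ?B * ?Y"
    using F0 by (subst (asm) mult_cancel_left) (auto simp: fps_eq_iff)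
  show ?thesis
    by (rule fps_ode_unique[OF X Y]) (simp add: W0)
qed

unbundle no fps_syntax and vec_syntax

section \<open>Signed sums over families with repetitions\<close>

lemma sum_Pow_image:
  fixes f :: "'b set \<Rightarrow> 'c :: comm_ring_1"
  assumes "finite E"
  shows "(\<Sum>S\<in>Pow E. (-1) ^ card S * f (h ` S)) = (\<Sum>B\<in>Pow (h ` E). (-1) ^ card B * f B)"
  using assms
proof (induction E arbitrary: f rule: finite_induct)
  case (insert e E)
  have card_ins: "card (insert x S) = Suc (card S)" if "S \<in> Pow F" "x \<notin> F" "finite F" for x S and F :: "'x set"
    using that by (meson PowD card_insert_disjoint finite_subset subsetD)
  have "(\<Sum>S\<in>Pow (insert e E). (-1) ^ card S * f (h ` S)) =
    (\<Sum>S\<in>Pow E. (-1) ^ card S * f (h ` S)) + (\<Sum>S\<in>Pow E. - ((-1) ^ card S * f (insert (h e) (h ` S))))"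
    using insert.hyps by (simp add: sum_Pow_insert card_ins)
  also have "\<dots> = (\<Sum>B\<in>Pow (h ` E). (-1) ^ card B * f B) -
      (\<Sum>B\<in>Pow (h ` E). (-1) ^ card B * f (insert (h e) B))"
    using insert.IH[of f] insert.IH[of "\<lambda>B. f (insert (h e) B)"] by (simp add: sum_negf)
  also have "\<dots> = (\<Sum>B\<in>Pow (h ` insert e E). (-1) ^ card B * f B)"
  proof (cases "h e \<in> h ` E")
    case True
    \<comment> \<open>When \<open>h e\<close> is already present, adding or removing it pairs the
      sets \<open>B\<close> with opposite signs, so the subsets using the repeated element
      contribute 0.\<close>
    define F where "F = h ` E - {h e}"
    have F: "h ` E = insert (h e) F" "h e \<notin> F" "finite F"
      using True insert.hyps by (auto simp: F_def)
    have "(\<Sum>B\<in>Pow (h ` E). (-1) ^ card B * f (insert (h e) B)) = 0"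
      unfolding F(1) sum_Pow_insert[OF F(3,2)] using F by (simp add: card_ins sum_negf)
    then show ?thesis
      using True by (simp add: insert_absorb)
  next
    case False
    then show ?thesis
      using insert.hyps by (simp add: sum_Pow_insert card_ins sum_negf)
  qed
  finally show ?case .
qed simp

section \<open>The arrangement of a set of rational numbers\<close>

definition hyperplane :: "nat \<Rightarrow> ('d \<Rightarrow> real) \<Rightarrow> 'd edge \<Rightarrow> (nat \<Rightarrow> real) set" where
  "hyperplane n g e = affine_hyperplane n (normal g e) 0"

lemma hyperplane_eq:
  "e \<in> edges {..<n} D \<Longrightarrow> hyperplane n g e = {x\<in>Rn n. edge_form g e x = 0}"
  by (simp add: hyperplane_def affine_hyperplane_def dotn_normal)

lemma normal_ne_0: "normal g e \<noteq> 0"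
proof -
  have "\<exists>k. normal g e k = 1"
  proof (cases e)
    case (Link i j d)
    then show ?thesis
      by (intro exI[of _ i]) simp
  qed simp
  then show ?thesis
    by auto
qed

text \<open>The origin lies on the hyperplane, so \<open>b = 0\<close>; by duality a normal outside
  the span would be nonzero at some point of the hyperplane.\<close>

lemma normals_hyperplane:
  assumes "e \<in> edges {..<n} D"
  shows "normals n (hyperplane n g e) \<subseteq> fn.span {normal g e}" "normal g e \<in> normals n (hyperplane n g e)"
proof -
  let ?c = "normal g e"
  have Rn: "?c \<in> Rn n"
    using assms by (rule normal_in_Rn)
  show "?c \<in> normals n (hyperplane n g e)"
    using Rn normal_ne_0[of g e] by (auto simp: normals_def hyperplane_def)
  show "normals n (hyperplane n g e) \<subseteq> fn.span {?c}"
  proof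
    fix d assume "d \<in> normals n (hyperplane n g e)"
    then obtain b where d: "d \<in> Rn n" and eq: "\<And>x. x \<in> Rn n \<Longrightarrow> dotn n ?c x = 0 \<longleftrightarrow> dotn n d x = b"
      unfolding normals_def hyperplane_def affine_hyperplane_def by blast
    have "b = 0"
      using eq[of 0] by (simp add: dotn_simps Rn_simps)
    then show "d \<in> fn.span {?c}"
      using dual_vector[of "{?c}" n d] d Rn eq by auto
  qed
qed

lemma arr_rank_hyperplanes:
  assumes "S \<subseteq> edges {..<n} D"
  shows "arr_rank n (hyperplane n g ` S) = rk g S"
proof -
  have "normals n (hyperplane n g e) \<subseteq> fn.span (normal g ` S)" if "e \<in> S" for e
  proof -
    have "fn.span {normal g e} \<subseteq> fn.span (normal g ` S)"
      using that by (intro fn.span_mono) auto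
    then show ?thesis
      using normals_hyperplane(1)[of e n D g] assms that by blast
  qed
  then have 1: "(\<Union>H\<in>hyperplane n g ` S. normals n H) \<subseteq> fn.span (normal g ` S)"
    by blast
  have "normal g ` S \<subseteq> (\<Union>H\<in>hyperplane n g ` S. normals n H)"
    using normals_hyperplane(2)[of _ n D g] assms by blast
  then have 2: "normal g ` S \<subseteq> fn.span (\<Union>H\<in>hyperplane n g ` S. normals n H)"
    using fn.span_superset by (rule order_trans)
  have "fn.span (\<Union>H\<in>hyperplane n g ` S. normals n H) = fn.span (normal g ` S)"
    using 1 2 unfolding fn.span_eq ..
  then show ?thesis
    unfolding arr_rank_def rk_def by (rule fn.span_eq_dim)
qed

text \<open>All hyperplanes meet at the origin, so every subset counts, and edges giving the same
  hyperplane cancel by \<open>sum_Pow_image\<close>.\<close>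

lemma char_poly_hyperplanes:
  assumes "finite D"
  shows "char_poly n (hyperplane n g ` edges {..<n} D) = whitney g D {..<n}"
proof -
  let ?E = "edges {..<n} D"
  have monom: "monom ((-1 :: rat) ^ c) k = (-1) ^ c * monom 1 k" for c k
    by (cases "even c") (simp_all flip: minus_monom)
  have "{B. B \<subseteq> hyperplane n g ` ?E \<and> \<Inter>B \<inter> Rn n \<noteq> {}} = Pow (hyperplane n g ` ?E)"
  proof -
    have "0 \<in> \<Inter>B \<inter> Rn n" if "B \<subseteq> hyperplane n g ` ?E" for B
      using that by (auto simp: hyperplane_def affine_hyperplane_def dotn_simps Rn_simps)
    then show ?thesis
      by blast
  qed
  then have "char_poly n (hyperplane n g ` ?E) =
      (\<Sum>S\<in>Pow ?E. (-1) ^ card S * monom 1 (n - arr_rank n (hyperplane n g ` S)))"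
    unfolding char_poly_def monom using assms
    by (simp add: sum_Pow_image[of ?E "\<lambda>B. monom 1 (n - arr_rank n B)"] finite_edges)
  also have "\<dots> = whitney g D {..<n}"
    unfolding whitney_def monom by (rule sum.cong) (auto simp: arr_rank_hyperplanes)
  finally show ?thesis .
qed

text \<open>The sign-vector count with no constraints, rewritten as a value at -1; the bound
  \<open>rk g S \<le> n\<close> converts the sign of the rank into that of the exponent.\<close>

lemma regions_hyperplanes:
  assumes "finite D"
  shows "rat_of_nat (regions n (hyperplane n g ` edges {..<n} D)) =
    (-1) ^ n * poly (whitney g D {..<n}) (-1)"
proof -
  let ?E = "edges {..<n} D"
  have E: "finite ?E" "normal g ` ?E \<subseteq> Rn n"
    using assms finite_edges normal_in_Rn by blast+
  have "Rn n - \<Union> (hyperplane n g ` ?E) = complement n (normal g) {} ?E"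
    by (auto simp: complement_def hyperplane_def affine_hyperplane_def)
  then have "int (regions n (hyperplane n g ` ?E)) = (\<Sum>S\<in>Pow ?E. (-1) ^ card S * (-1) ^ rk g S)"
    using E rk_empty[of g] card_sign_vec[OF E, of "{}"]
    by (simp add: regions_def card_components_complement rk_def)
  then have "rat_of_int (int (regions n (hyperplane n g ` ?E))) =
      (\<Sum>S\<in>Pow ?E. (-1) ^ card S * (-1) ^ rk g S)"
    by simp
  also have "\<dots> = (\<Sum>S\<in>Pow ?E. (-1) ^ n * ((-1) ^ card S * (-1) ^ (n - rk g S)))"
  proof (rule sum.cong)
    fix S assume "S \<in> Pow ?E"
    then have "rk g S \<le> n"
      using rk_le_card[of "{..<n}" S D g] E(1) finite_subset by auto
    then have "(-1 :: rat) ^ rk g S = (-1) ^ n * (-1) ^ (n - rk g S)"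
      by (simp add: minus_one_power_iff)
    then show "(-1 :: rat) ^ card S * (-1) ^ rk g S = (-1) ^ n * ((-1) ^ card S * (-1) ^ (n - rk g S))"
      by simp
  qed simp
  finally show ?thesis
    by (simp add: whitney_def poly_sum poly_monom sum_distrib_left)
qed

text \<open>The additional gain 1 encodes the equalities of coordinates. These are listed in one
  order only in \<open>arrA\<close>, which \<open>swap\<close> reconciles with the ordered pairs of
  \<open>edges\<close>.\<close>

lemma arrA_eq: "arrA n a = hyperplane n of_rat ` edges {..<n} (insert 1 a)"
proof -
  let ?h = "hyperplane n of_rat" and ?E = "edges {..<n} (insert 1 a)"
  have Half: "affine_hyperplane n (\<lambda>k. if k = i then 1 else 0) 0 = ?h (Half i)" for i
    by (simp add: hyperplane_def)
  have Link: "affine_hyperplane n (\<lambda>k. if k = i then 1 else if k = j then - of_rat r else 0) 0 =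
      ?h (Link i j r)" for i j r
    by (simp add: hyperplane_def)
  have Link1: "affine_hyperplane n (\<lambda>k. if k = i then 1 else if k = j then -1 else 0) 0 =
      ?h (Link i j 1)" for i j
    by (simp only: hyperplane_def normal.simps of_rat_1)
  have swap: "?h (Link i j 1) = ?h (Link j i 1)" if "i < n" "j < n" "i \<noteq> j" for i j
    using that hyperplane_eq[of "Link i j 1" n "{1}" of_rat] hyperplane_eq[of "Link j i 1" n "{1}" of_rat]
    by auto
  show ?thesis
    unfolding arrA_def Half Link Link1
  proof (intro equalityI subsetI)
    fix H assume "H \<in> ?h ` ?E"
    then obtain e where e: "e \<in> ?E" "H = ?h e"
      by blast
    show "H \<in> {?h (Half i) |i. i < n} \<union> {?h (Link i j 1) |i j. i < j \<and> j < n} \<union>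
        {?h (Link i j r) |i j r. i < n \<and> j < n \<and> i \<noteq> j \<and> r \<in> a}"
    proof (cases e)
      case (Link i j d)
      show ?thesis
      proof (cases "d = 1")
        case True
        then show ?thesis
          using e Link swap[of i j] by (cases i j rule: linorder_cases) auto
      next
        case False
        then have "i < n" "j < n" "i \<noteq> j" "d \<in> a"
          using e(1) Link by auto
        then show ?thesis
          using e(2) Link by blast
      qed
    qed (use e in auto)
  qed auto
qed

section \<open>Multiplicatively independent gains\<close>

text \<open>Solutions of a system of edges can be transported along an equivariant map from the orbits of
  the group generated by the values of \<open>q\<close> to those of the group generated by \<open>p\<close>; it suffices to
  keep the single orbit of a coordinate witnessing that \<open>e\<close> fails, and to send all others to 0.\<close>

lemma dep_transfer:
  fixes p q :: "'d \<Rightarrow> real" and b :: "'d set"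
  defines "P \<equiv> \<lambda>e :: 'd \<Rightarrow> int. \<Prod>y\<in>b. p y powi e y"
  defines "Q \<equiv> \<lambda>e :: 'd \<Rightarrow> int. \<Prod>y\<in>b. q y powi e y"
  assumes b: "finite b" "\<And>y. y \<in> b \<Longrightarrow> p y > 0" "\<And>y. y \<in> b \<Longrightarrow> q y > 0"
    and u: "u \<notin> b" "p u = 1" "q u = 1"
    and indep: "\<forall>e. P e = 1 \<longrightarrow> (\<forall>y\<in>b. e y = 0)" "\<forall>e. Q e = 1 \<longrightarrow> (\<forall>y\<in>b. e y = 0)"
    and S: "S \<subseteq> edges U (insert u b)" "e \<in> edges U (insert u b)"
    and dep: "dep p S e"
  shows "dep q S e"
  unfolding dep_def
proof (intro allI impI, rule ccontr)
  fix x assume x: "\<forall>s\<in>S. edge_form q s x = 0" and nz: "edge_form q e x \<noteq> 0"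
  have PQ_add: "P (\<lambda>y. k y + l y) = P k * P l" "Q (\<lambda>y. k y + l y) = Q k * Q l"
    "P (\<lambda>y. k y - l y) = P k / P l" "Q (\<lambda>y. k y - l y) = Q k / Q l" for k l
    unfolding P_def Q_def using b
    by (auto simp: power_int_add power_int_diff less_imp_neq[THEN not_sym]
        simp flip: prod.distrib prod_dividef intro!: prod.cong)
  have PQ_pos: "P k > 0" "Q k > 0" for k
    unfolding P_def Q_def using b by (auto intro!: prod_pos)
  have PQ_cong: "P k = P l" "Q k = Q l" if "\<And>y. y \<in> b \<Longrightarrow> k y = l y" for k l
    unfolding P_def Q_def using that by (auto intro!: prod.cong)
  \<comment> \<open>Independence recovers the exponents on \<open>b\<close> from either product, so
    \<open>P\<close> and \<open>Q\<close> identify the same exponent vectors.\<close>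
  have PQ_inj: "k y = l y" if "P k = P l \<or> Q k = Q l" "y \<in> b" for k l y
    using indep[rule_format, of "\<lambda>y. k y - l y" y] that PQ_pos[of l] unfolding PQ_add by auto
  \<comment> \<open>The exponent vector of a single label; for \<open>d = u\<close> it is 0 on
    \<open>b\<close>, matching the gain 1 of \<open>u\<close>.\<close>
  define \<delta> :: "'d \<Rightarrow> 'd \<Rightarrow> int" where "\<delta> = (\<lambda>d y. if y = d then 1 else 0)"
  have PQ_\<delta>: "P (\<delta> d) = p d" "Q (\<delta> d) = q d" if "d \<in> insert u b" for d
  proof -
    have "(\<Prod>y\<in>b. f y powi \<delta> d y) = (\<Prod>y\<in>b. if y = d then f y else 1)" for f :: "'d \<Rightarrow> real"
      by (rule prod.cong) (auto simp: \<delta>_def)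
    then show "P (\<delta> d) = p d" "Q (\<delta> d) = q d"
      using that u b(1) by (auto simp: P_def Q_def)
  qed
  \<comment> \<open>Identifies the orbit of \<open>s\<close> with that of 1 by sending
    \<open>Q k * s\<close> to \<open>P k\<close>, and sends everything else to 0.\<close>
  define T where "T = (\<lambda>s z. if \<exists>k. z = Q k * s then P (SOME k. z = Q k * s) else 0)"
  have T: "T s (Q k * s) = P k" if "s \<noteq> 0" for s k
  proof -
    have ex: "\<exists>l. Q k * s = Q l * s"
      by blast
    define l where "l = (SOME l. Q k * s = Q l * s)"
    have "Q k * s = Q l * s"
      unfolding l_def by (rule someI_ex[OF ex])
    then have "Q k = Q l"
      using that by simp
    then have "P k = P l"
      using PQ_inj PQ_cong(1) by blast
    then show ?thesis
      unfolding T_def using ex by (simp add: l_def)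
  qed
  have T_0: "T s z = 0" if "\<And>k. z \<noteq> Q k * s" for s z
    using that by (simp add: T_def)
  have T_zero: "T s 0 = 0" if "s \<noteq> 0" for s
    using that PQ_pos(2) by (intro T_0) (metis less_irrefl mult_eq_0_iff)
  \<comment> \<open>This equivariance turns a link equation with gain \<open>q d\<close> into one
    with gain \<open>p d\<close>.\<close>
  have T_equiv: "T s (q d * z) = p d * T s z" if "s \<noteq> 0" "d \<in> insert u b" for s d z
  proof (cases "\<exists>k. z = Q k * s")
    case True
    then obtain k where "z = Q k * s"
      by blast
    then have "q d * z = Q (\<lambda>y. \<delta> d y + k y) * s"
      by (simp add: PQ_add PQ_\<delta>[OF that(2)])
    then have "T s (q d * z) = P (\<lambda>y. \<delta> d y + k y)"
      using T that(1) by simp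
    then show ?thesis
      using \<open>z = Q k * s\<close> T that(1) by (simp add: PQ_add PQ_\<delta>[OF that(2)])
  next
    case False
    have "q d * z \<noteq> Q k * s" for k
    proof
      assume "q d * z = Q k * s"
      then have "z = Q (\<lambda>y. k y - \<delta> d y) * s"
        using PQ_pos(2)[of "\<delta> d"] by (simp add: PQ_add PQ_\<delta>[OF that(2)] field_simps)
      then show False
        using False by blast
    qed
    then show ?thesis
      using False T_0 by simp
  qed
  have "edge_form p t (T s \<circ> x) = 0" if "s \<noteq> 0" "t \<in> S" for s t
  proof -
    have "t \<in> edges U (insert u b)" "edge_form q t x = 0"
      using S(1) x that(2) by auto
    then show ?thesis
      using T_zero T_equiv that(1) by (cases t) auto
  qed
  then have sol: "edge_form p e (T s \<circ> x) = 0" if "s \<noteq> 0" for s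
    using dep that by (auto simp: dep_def)
  have T_self: "T s s = 1" if "s \<noteq> 0" for s
    using T[OF that, of "\<lambda>_. 0"] by (simp add: P_def Q_def)
  show False
  proof (cases e)
    case (Half i)
    then show False
      using sol[of "x i"] nz T_self[of "x i"] by simp
  next
    case (Link i j d)
    then have d: "d \<in> insert u b"
      using S(2) by simp
    show False
    \<comment> \<open>The orbit of \<open>x j\<close> detects the failing link unless
      \<open>x j\<close> is 0; then \<open>x i\<close> is nonzero and serves instead.\<close>
    proof (cases "x j = 0")
      case True
      then show False
        using sol[of "x i"] nz T_self[of "x i"] T_zero[of "x i"] Link by simp
    next
      case False
      then have eq: "T (x j) (x i) = p d"
        using sol[of "x j"] T_self[of "x j"] Link by simp
      moreover have "p d > 0"
        using d b u by auto
      ultimately obtain k where k: "x i = Q k * x j"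
        using T_0[of "x i" "x j"] by fastforce
      \<comment> \<open>Equal \<open>P\<close> values force equal \<open>Q\<close> values, so
        \<open>x i = q d * x j\<close> after all.\<close>
      then have "P k = P (\<delta> d)"
        using eq T[OF False] PQ_\<delta>[OF d] by simp
      then have "Q k = Q (\<delta> d)"
        using PQ_inj PQ_cong(2) by blast
      then show False
        using k nz Link PQ_\<delta>[OF d] by simp
    qed
  qed
qed

lemma of_rat_powi: "of_rat (x powi k) = (of_rat x :: 'a :: field_char_0) powi k"
  by (simp add: power_int_def of_rat_power of_rat_inverse)

text \<open>Any bijection of \<open>b\<close> with \<open>c\<close>, extended by fixing 1, preserves
  dependence, since solutions transfer in both directions.\<close>

lemma whitney_mult_indep:
  assumes b: "finite b" "\<And>r. r \<in> b \<Longrightarrow> r > 0" "mult_indep b"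
    and c: "finite c" "\<And>r. r \<in> c \<Longrightarrow> r > 0" "mult_indep c"
    and "card b = card c" and "finite U"
  shows "whitney of_rat (insert 1 b) U = whitney of_rat (insert 1 c) U"
proof -
  \<comment> \<open>An independent set cannot contain 1, so the label 1 is new on both
    sides.\<close>
  have one: "1 \<notin> s" if s: "finite s" "mult_indep s" for s :: "rat set"
  proof
    assume "1 \<in> s"
    have "(\<Prod>x\<in>s. x powi (if x = 1 then 1 else 0)) = 1"
      by (rule prod.neutral) auto
    then show False
      using s(2)[unfolded mult_indep_def, rule_format, OF _ \<open>1 \<in> s\<close>, of "\<lambda>x. if x = 1 then 1 else 0"]
      by simp
  qed
  obtain h0 where h0: "bij_betw h0 b c"
    using finite_same_card_bij[OF b(1) c(1) assms(7)] by blast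
  define h where "h = h0(1 := 1)"
  have h: "bij_betw h b c" "h 1 = 1"
  proof -
    show "bij_betw h b c"
      using h0 one[OF b(1,3)] by (subst bij_betw_cong[of _ _ h0]) (auto simp: h_def)
  qed (simp add: h_def)
  then have h_ins: "bij_betw h (insert 1 b) (insert 1 c)"
    using one b c by (metis notIn_Un_bij_betw3 Un_insert_right Un_empty_right)
  define p where "p = (of_rat :: rat \<Rightarrow> real)"
  \<comment> \<open>The gains of \<open>c\<close> are pulled back along \<open>h\<close>, so that
    both gain functions live on the labels of \<open>b\<close>.\<close>
  define q where "q = (of_rat :: rat \<Rightarrow> real) \<circ> h"
  have p_pos: "p y > 0" and q_pos: "q y > 0" if "y \<in> b" for y
    using that b(2) c(2) bij_betw_apply[OF h(1)] by (auto simp: p_def q_def)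
  have pq_1: "p 1 = 1" "q 1 = 1"
    by (auto simp: p_def q_def h)
  have p_indep: "e y = 0" if "(\<Prod>y\<in>b. p y powi e y) = 1" "y \<in> b" for e y
  proof -
    have "of_rat (\<Prod>y\<in>b. y powi e y) = (1 :: real)"
      using that(1) by (simp add: p_def of_rat_prod of_rat_powi)
    then show ?thesis
      using b(3) that(2) by (auto simp: mult_indep_def)
  qed
  have q_indep: "e y = 0" if "(\<Prod>y\<in>b. q y powi e y) = 1" "y \<in> b" for e y
  proof -
    let ?e = "e \<circ> inv_into b h"
    have "(\<Prod>y\<in>b. q y powi e y) = (\<Prod>y\<in>b. of_rat (h y powi ?e (h y)))"
      using bij_betw_inv_into_left[OF h(1)] by (intro prod.cong) (auto simp: q_def of_rat_powi)
    also have "\<dots> = (\<Prod>z\<in>c. of_rat (z powi ?e z))"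
      by (rule prod.reindex_bij_betw[OF h(1)])
    finally have "of_rat (\<Prod>z\<in>c. z powi ?e z) = (1 :: real)"
      using that(1) by (simp add: of_rat_prod)
    then have "?e (h y) = 0"
      using c(3) that(2) bij_betw_apply[OF h(1)] by (simp only: of_rat_eq_1_iff) (auto simp: mult_indep_def)
    then show ?thesis
      using that(2) bij_betw_inv_into_left[OF h(1)] by simp
  qed
  have "dep p T e \<longleftrightarrow> dep of_rat (relabel id h ` T) (relabel id h e)"
    if T: "T \<subseteq> edges U (insert 1 b)" "e \<in> edges U (insert 1 b)" for T e
  proof -
    have pq: "\<forall>e. (\<Prod>y\<in>b. p y powi e y) = 1 \<longrightarrow> (\<forall>y\<in>b. e y = 0)"
      "\<forall>e. (\<Prod>y\<in>b. q y powi e y) = 1 \<longrightarrow> (\<forall>y\<in>b. e y = 0)"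
      using p_indep q_indep by blast+
    have "dep p T e \<longleftrightarrow> dep q T e"
      using dep_transfer[OF b(1) p_pos q_pos one[OF b(1,3)] pq_1 pq T]
        dep_transfer[OF b(1) q_pos p_pos one[OF b(1,3)] pq_1(2,1) pq(2,1) T] by blast
    then show ?thesis
      by (simp add: dep_def edge_form_relabel q_def)
  qed
  then show ?thesis
    using assms bij_betw_relabel[OF bij_betw_id h_ins, of U]
    by (intro whitney_cong[where h = "relabel id h"]) (auto simp: p_def)
qed

theorem theorem2p2:
  fixes a :: "rat set"
  assumes "finite a" and "\<forall>r\<in>a. r > 0 \<and> r \<noteq> 1"
  shows "Abs_fps (\<lambda>n. smult (1 / fact n) (char_poly n (arrA n a)))
           = fps_powr_poly
               (Abs_fps (\<lambda>n. [: (-1) ^ n * of_nat (regions n (arrA n a)) / fact n :]))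
               [: 1/2, -1/2 :]
         \<and> (\<forall>m n b c. finite b \<and> finite c \<and> card b = m \<and> card c = m
            \<and> (\<forall>r\<in>b. r > 0) \<and> (\<forall>r\<in>c. r > 0) \<and> mult_indep b \<and> mult_indep c
            \<longrightarrow> regions n (arrA n b) = regions n (arrA n c))"
proof
  define W where "W = (\<lambda>n. whitney of_rat (insert 1 a) {..<n})"
  have fin: "finite (insert 1 a)"
    using assms(1) by simp
  have nz: "(of_rat d :: real) \<noteq> 0" if "d \<in> insert 1 a" for d
    using that assms(2) by auto
  have "egf W = fps_powr_poly (egf (\<lambda>n. [:poly (W n) (-1):])) [:1/2, -1/2:]"
  \<comment> \<open>\<open>\<beta> k\<close> is the linear coefficient of the connected part on
    \<open>k + 1\<close> vertices.\<close>
  proof (rule egf_eq_powr[where \<beta> = "\<lambda>k. poly (pderiv (W (Suc k))) 1"])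
    show "W 0 = 1"
      by (simp add: W_def)
    show "W (Suc n) = (\<Sum>k\<le>n. of_nat (n choose k) *
        (smult (poly (pderiv (W (Suc k))) 1) [:-1, 1:] * W (n - k)))" for n
      unfolding W_def by (rule whitney_Suc[OF fin nz])
  qed
  moreover have "char_poly n (arrA n a) = W n" for n
    using char_poly_hyperplanes[OF fin] by (simp add: arrA_eq W_def)
  \<comment> \<open>The sign \<open>(-1) ^ n\<close> cancels the one in the region count, leaving
    the value at -1.\<close>
  moreover have "[:(-1) ^ n * of_nat (regions n (arrA n a)) / fact n:] = smult (1 / fact n) [:poly (W n) (-1):]" for n
    using regions_hyperplanes[OF fin] by (simp add: arrA_eq W_def flip: power_mult_distrib mult.assoc)
  ultimately show "Abs_fps (\<lambda>n. smult (1 / fact n) (char_poly n (arrA n a))) =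
      fps_powr_poly (Abs_fps (\<lambda>n. [: (-1) ^ n * of_nat (regions n (arrA n a)) / fact n :])) [: 1/2, -1/2 :]"
    by (simp add: egf_def)
  show "\<forall>m n b c. finite b \<and> finite c \<and> card b = m \<and> card c = m
            \<and> (\<forall>r\<in>b. r > 0) \<and> (\<forall>r\<in>c. r > 0) \<and> mult_indep b \<and> mult_indep c
            \<longrightarrow> regions n (arrA n b) = regions n (arrA n c)"
  proof (intro allI impI, elim conjE)
    fix m n and b c :: "rat set"
    assume *: "finite b" "finite c" "card b = m" "card c = m" "\<forall>r\<in>b. r > 0" "\<forall>r\<in>c. r > 0"
      "mult_indep b" "mult_indep c"
    then have "whitney of_rat (insert 1 b) {..<n} = whitney of_rat (insert 1 c) {..<n}"
      by (intro whitney_mult_indep) auto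
    then have "rat_of_nat (regions n (arrA n b)) = rat_of_nat (regions n (arrA n c))"
      using * regions_hyperplanes[of "insert 1 b" n of_rat] regions_hyperplanes[of "insert 1 c" n of_rat]
      by (simp add: arrA_eq)
    then show "regions n (arrA n b) = regions n (arrA n c)"
      by simp
  qed
qed

end
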